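(* Let $1\le d<D$ and $k\ge 3$ be integers, $R_{\min}>0$, $\mathbf{L}=(L_\perp,L_3,\dots,L_k)$. If $\mathbf{M}\in\mathfrak{C}^k_{R_{\min},\mathbf{L}}$, $R=R(\mathbf{M})$ is its reach and $R_\ell=R_\ell(\mathbf{M})$ its local reach, then for all $t\in[0,R)$, $$h_{\mathbf{M}}(t)\le R_\ell-\sqrt{R_\ell^2-t^2},$$ i.e. on $[0,R)$ the convexity defect function $h_{\mathbf{M}}$ is bounded above by a quarter-circle of radius $R_\ell$ centered on $(0,R_\ell)$.
   Context: Reach: $R(\mathbf{M})$ is the supremum of all $\delta\ge 0$ such that every point of $\mathbf{R}^D$ at distance less than $\delta$ from $\mathbf{M}$ has a unique nearest point in $\mathbf{M}$. Local reach: $R_\ell(\mathbf{M})=\inf_{p\in\mathbf{M}}1/\|\mathrm{II}_p\|_{\mathrm{op}}$, where $\mathrm{II}_p$ is the second fundamental form of $\mathbf{M}\subseteq\mathbf{R}^D$ at $p$. Class of manifolds: for $d<D$, $k\ge 3$, $R_{\min}>0$ and $\mathbf{L}=(L_\perp,L_3,\dots,L_k)$ (positive numbers), $\mathfrak{C}^k_{R_{\min},\mathbf{L}}$ is the set of $d$-dimensional compact connected submanifolds $\mathbf{M}$ of $\mathbf{R}^D$ such that: (i) $R(\mathbf{M})\ge R_{\min}$; (ii) for all $p\in\mathbf{M}$ there is a local one-to-one parametrization $\psi_p:B_{T_p\mathbf{M}}(0,r)\subseteq T_p\mathbf{M}\to\mathbf{M}$, $v\mapsto p+v+\mathbf{N}_p(v)$,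 for some $r\ge\frac1{4L_\perp}$, with $\mathbf{N}_p\in C^k(B_{T_p\mathbf{M}}(0,r),\mathbf{R}^D)$, $\mathbf{N}_p(0)=0$, $d_0\mathbf{N}_p=0$, and $\|d_v^2\mathbf{N}_p\|_{\mathrm{op}}\le L_\perp$ for all $\|v\|\le\frac1{4L_\perp}$; (iii) $\|d_v^i\mathbf{N}_p\|_{\mathrm{op}}\le L_i$ for all $3\le i\le k$ and $\|v\|\le\frac1{4L_\perp}$. Convexity defect function: for compact $\sigma\subseteq\mathbf{R}^D$, $\mathrm{Rad}(\sigma)$ is the radius of the smallest closed ball containing $\sigma$ and $\mathrm{Hull}(\sigma)$ is its convex hull. For compact $\mathbf{X}\subseteq\mathbf{R}^D$ and $t\ge 0$, $\mathrm{Hull}(\mathbf{X},t)=\bigcup_{\sigma\subseteq\mathbf{X},\ \mathrm{Rad}(\sigma)\le t}\mathrm{Hull}(\sigma)$ (union over nonempty compact $\sigma$), and $h_{\mathbf{X}}(t)=\sup_{y\in\mathrm{Hull}(\mathbf{X},t)}d(y,\mathbf{X})$, which is the Hausdorff distance between $\mathrm{Hull}(\mathbf{X},t)$ and $\mathbf{X}$. *)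

theory Defs
  imports "HOL-Analysis.Analysis"
begin

text \<open>
  \<open>iter_deriv f S [h\<^sub>1, \<dots>, h\<^sub>i] x\<close> is the value of the \<open>i\<close>-th derivative of \<open>f\<close> at \<open>x\<close> on the vectors
  \<open>h\<^sub>1, \<dots>, h\<^sub>i\<close>. It is used for a set \<open>S\<close> that is open in a linear subspace \<open>V\<close>
  and for vectors in \<open>V\<close>: in these directions the derivative within \<open>S\<close> is unique, although
  the linear map \<open>frechet_derivative f (at x within S)\<close> on the whole space is not.
\<close>
primrec iter_deriv ::
  "('a::real_normed_vector \<Rightarrow> 'b::real_normed_vector) \<Rightarrow> 'a set \<Rightarrow> 'a list \<Rightarrow> 'a \<Rightarrow> 'b" where
  "iter_deriv f S [] = f"
| "iter_deriv f S (h # hs) = (\<lambda>x. frechet_derivative (iter_deriv f S hs) (at x within S) h)"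

text \<open>
  \<open>f\<close> is of class \<open>C\<^sup>k\<close> on \<open>S\<close>, an open subset of the linear subspace \<open>V\<close>. In finite dimension,
  differentiability and continuity of a derivative as a multilinear map are equivalent to
  those of its values on fixed vectors.
\<close>
definition Ck_on ::
  "nat \<Rightarrow> 'a::euclidean_space set \<Rightarrow> 'a set \<Rightarrow> ('a \<Rightarrow> 'b::euclidean_space) \<Rightarrow> bool" where
  "Ck_on k V S f \<longleftrightarrow>
     (\<forall>hs. set hs \<subseteq> V \<and> length hs < k \<longrightarrow> iter_deriv f S hs differentiable_on S) \<and>
     (\<forall>hs. set hs \<subseteq> V \<and> length hs = k \<longrightarrow> continuous_on S (iter_deriv f S hs))"

definition deriv_onorm ::
  "('a::euclidean_space \<Rightarrow> 'b::euclidean_space) \<Rightarrow> 'a set \<Rightarrow> 'a set \<Rightarrow> nat \<Rightarrow> 'a \<Rightarrow> ereal" where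
  "deriv_onorm f V S i x =
     (SUP hs \<in> {hs. length hs = i \<and> set hs \<subseteq> V \<inter> cball 0 1}. ereal (norm (iter_deriv f S hs x)))"

text \<open>Embedded \<open>C\<^sup>k\<close> submanifold without boundary, by charts of the ambient space that flatten \<open>M\<close>.\<close>
definition submanifold :: "nat \<Rightarrow> nat \<Rightarrow> 'a::euclidean_space set \<Rightarrow> bool" where
  "submanifold k d M \<longleftrightarrow>
     (\<forall>p\<in>M. \<exists>U W \<Phi> \<Psi> S. open U \<and> p \<in> U \<and> open W \<and> homeomorphism U W \<Phi> \<Psi> \<and>
        Ck_on k UNIV U \<Phi> \<and> Ck_on k UNIV W (\<Psi> :: 'a \<Rightarrow> 'a) \<and>
        subspace S \<and> dim S = d \<and> \<Phi> ` (M \<inter> U) = W \<inter> S)"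

definition tangent_space :: "'a::euclidean_space set \<Rightarrow> 'a \<Rightarrow> 'a set" where
  "tangent_space M p =
     {v. \<exists>\<gamma> \<epsilon>. 0 < \<epsilon> \<and> \<gamma> C1_differentiable_on {-\<epsilon><..<\<epsilon>} \<and> \<gamma> ` {-\<epsilon><..<\<epsilon>} \<subseteq> M \<and>
        \<gamma> 0 = p \<and> (\<gamma> has_vector_derivative v) (at 0)}"

text \<open>
  \<open>II\<^sub>p(u, v)\<close> is the normal component at \<open>p\<close> of the derivative in direction \<open>u\<close> of a \<open>C\<^sup>1\<close>
  vector field \<open>Y\<close>, defined near \<open>p\<close> in the ambient space and tangent to \<open>M\<close> along \<open>M\<close>, with
  \<open>Y p = v\<close>. On a submanifold of class at least \<open>C\<^sup>2\<close> and for tangent \<open>u, v\<close> such a field exists and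
  the normal component does not depend on the choice of it.
\<close>
definition second_fundamental_form :: "'a::euclidean_space set \<Rightarrow> 'a \<Rightarrow> 'a \<Rightarrow> 'a \<Rightarrow> 'a" where
  "second_fundamental_form M p u v =
     (THE w. \<exists>U Y. open U \<and> p \<in> U \<and> Ck_on 1 UNIV U Y \<and>
        (\<forall>x \<in> M \<inter> U. Y x \<in> tangent_space M x) \<and> Y p = v \<and>
        w \<in> orthogonal_comp (tangent_space M p) \<and>
        frechet_derivative Y (at p) u - w \<in> tangent_space M p)"

definition second_fundamental_form_onorm :: "'a::euclidean_space set \<Rightarrow> 'a \<Rightarrow> ereal" where
  "second_fundamental_form_onorm M p =
     (SUP (u, v) \<in> (tangent_space M p \<inter> cball 0 1) \<times> (tangent_space M p \<inter> cball 0 1).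
        ereal (norm (second_fundamental_form M p u v)))"

definition reach :: "'a::euclidean_space set \<Rightarrow> ereal" where
  "reach M =
     (SUP \<delta> \<in> {\<delta>. 0 \<le> \<delta> \<and>
        (\<forall>x. infdist x M < \<delta> \<longrightarrow> (\<exists>!q. q \<in> M \<and> dist x q = infdist x M))}. ereal \<delta>)"

text \<open>In \<open>ereal\<close> one has \<open>1 / 0 = \<infinity>\<close>, so points with vanishing \<open>II\<^sub>p\<close> do not affect the infimum.\<close>
definition local_reach :: "'a::euclidean_space set \<Rightarrow> ereal" where
  "local_reach M = (INF p\<in>M. 1 / second_fundamental_form_onorm M p)"

text \<open>
  Here \<open>Lp\<close> stands for \<open>L\<^sub>\<bottom>\<close>. The domain \<open>B\<close> of \<open>N\<^sub>p\<close> is the open ball of radius \<open>r\<close> in \<open>T\<^sub>pM\<close>;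
  if \<open>r\<close> equals \<open>1 / (4 * Lp)\<close>, the bounds on the derivatives are required on \<open>B\<close> only, where
  the derivatives are defined.
\<close>
definition manifold_class ::
  "nat \<Rightarrow> nat \<Rightarrow> real \<Rightarrow> real \<Rightarrow> (nat \<Rightarrow> real) \<Rightarrow> 'a::euclidean_space set set" where
  "manifold_class d k Rmin Lp L =
     {M. M \<noteq> {} \<and> compact M \<and> connected M \<and> submanifold k d M \<and>
         ereal Rmin \<le> reach M \<and>
         (\<forall>p\<in>M. \<exists>r N. 1 / (4 * Lp) \<le> r \<and>
            (let T = tangent_space M p; B = T \<inter> ball 0 r; \<psi> = (\<lambda>v. p + v + N v) in
               inj_on \<psi> B \<and> \<psi> ` B \<subseteq> M \<and>
               Ck_on k T B N \<and> N 0 = 0 \<and> (N has_derivative (\<lambda>_. 0)) (at 0 within B) \<and>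
               (\<forall>v\<in>B. norm v \<le> 1 / (4 * Lp) \<longrightarrow>
                  deriv_onorm N T B 2 v \<le> ereal Lp \<and>
                  (\<forall>i\<in>{3..k}. deriv_onorm N T B i v \<le> ereal (L i)))))}"

definition Rad :: "'a::euclidean_space set \<Rightarrow> real" where
  "Rad \<sigma> = Inf {r. 0 \<le> r \<and> (\<exists>c. \<sigma> \<subseteq> cball c r)}"

definition Hull :: "'a::euclidean_space set \<Rightarrow> real \<Rightarrow> 'a set" where
  "Hull X t = (\<Union>\<sigma> \<in> {\<sigma>. \<sigma> \<subseteq> X \<and> \<sigma> \<noteq> {} \<and> compact \<sigma> \<and> Rad \<sigma> \<le> t}. convex hull \<sigma>)"

definition convexity_defect :: "'a::euclidean_space set \<Rightarrow> real \<Rightarrow> real" where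
  "convexity_defect X t = (SUP y \<in> Hull X t. infdist y X)"

end

theory Submission
  imports Defs
begin

text \<open>
  Let \<open>y\<close> be a point of \<open>Hull M t\<close>, at distance \<open>r\<close> from \<open>M\<close>, let \<open>q\<close> be its nearest point in \<open>M\<close>,
  and let \<open>\<rho>\<close> be the local reach. For \<open>r \<le> t \<le> \<rho>\<close> the claim says that \<open>2 \<rho> r \<le> t\<^sup>2 + r\<^sup>2\<close>.

  It holds as soon as the points of \<open>\<sigma>\<close>, where \<open>\<sigma> \<subseteq> M\<close> lies in a ball \<open>cball c t\<close> and \<open>y \<in> convex hull \<sigma>\<close>,
  avoid the open ball of radius \<open>\<rho>\<close> that touches \<open>M\<close> at \<open>q\<close> on the side of \<open>y\<close>. If \<open>z\<close> is the centre of
  that ball, then \<open>|x - c|\<^sup>2 - |x - z|\<^sup>2 \<le> t\<^sup>2 - \<rho>\<^sup>2\<close> for all \<open>x \<in> \<sigma>\<close>; this inequality is affine in \<open>x\<close>, so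
  it passes to \<open>y\<close>, where \<open>|y - z| = \<rho> - r\<close> (lemma \<open>foot_point_bound\<close>).

  The bound \<open>1 / \<rho>\<close> on the second fundamental form controls \<open>M\<close> only near \<open>q\<close>: by a Taylor expansion in a
  chart, for every \<open>R < \<rho>\<close> two points of \<open>M\<close> at a distance below some \<open>h\<^sub>0\<close> avoid each other's tangent balls
  of radius \<open>R\<close> (\<open>submanifold_avoids_tangent_balls_locally\<close>). The reach carries this over to all pairs at
  distance at most \<open>2 t'\<close>, for \<open>t'\<close> below the reach and \<open>R\<close>, without geodesics. For \<open>a\<close>, \<open>b\<close> in \<open>M\<close> let \<open>p\<close> be the point
  of \<open>M\<close> nearest to their midpoint \<open>m\<close>. As nearest points are unique, \<open>p\<close> is closer to \<open>m\<close> than \<open>a\<close> and \<open>b\<close> are,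
  so \<open>|p - a|\<close> and \<open>|p - b|\<close> are smaller than \<open>|a - b|\<close>, by a factor that compactness makes uniform. If the
  pairs \<open>(p, a)\<close>, \<open>(p, b)\<close>, \<open>(a, p)\<close> satisfy the estimate, then so does \<open>(a, b)\<close>: the first two bound \<open>|m - p|\<close> by the
  sagitta of the chord \<open>a b\<close> in a circle of radius \<open>R\<close>, and if \<open>b\<close> were inside a tangent ball at \<open>a\<close>, then \<open>m\<close>
  would be deeper inside than the sagitta, so \<open>p\<close> would be inside as well
  (\<open>avoids_tangent_balls_midpoint\<close>, \<open>avoids_tangent_balls_global\<close>).

  To apply this to \<open>q\<close> and the points of \<open>\<sigma>\<close>, the point \<open>q\<close> has to be close to \<open>c\<close>. The estimate itself gives
  \<open>|q - c| \<le> t\<close> whenever \<open>|q - c| < t'\<close>, so \<open>|q - c|\<close> takes no value in the gap between \<open>t\<close> and \<open>t'\<close>; since the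
  convex hull of \<open>\<sigma>\<close> is connected and contains \<open>\<sigma>\<close>, \<open>|q - c|\<close> stays below the gap
  (\<open>convex_hull_distance_bound\<close>). Letting \<open>R\<close> tend to \<open>\<rho>\<close> gives the claim.

  If \<open>\<rho> \<le> t\<close>, the right-hand side is at least \<open>t\<close>, and \<open>r \<le> t\<close> because some point of \<open>\<sigma>\<close> is that close to \<open>y\<close>.
\<close>

section \<open>Calculus of maps of class one and two\<close>

abbreviation fderiv :: "('a::real_normed_vector \<Rightarrow> 'b::real_normed_vector) \<Rightarrow> 'a \<Rightarrow> 'a \<Rightarrow> 'b" ("\<D>")
  where "\<D> f x \<equiv> frechet_derivative f (at x)"

lemma Ck_on_one_iff:
  assumes "open U"
  shows "Ck_on 1 UNIV U f \<longleftrightarrow>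
    (\<forall>x\<in>U. f differentiable at x) \<and> (\<forall>h. continuous_on U (\<lambda>x. \<D> f x h))"
proof -
  have "continuous_on U (iter_deriv f U [h]) \<longleftrightarrow> continuous_on U (\<lambda>x. \<D> f x h)" for h
    by (rule continuous_on_cong) (simp_all add: at_within_open[OF _ assms])
  moreover have "f differentiable_on U \<longleftrightarrow> (\<forall>x\<in>U. f differentiable at x)"
    by (simp add: differentiable_on_def at_within_open[OF _ assms] cong: ball_cong)
  ultimately show ?thesis
    by (simp add: Ck_on_def length_Suc_conv del: iter_deriv.simps(2))
       (auto simp del: iter_deriv.simps(2))
qed

lemma Ck_on_mono:
  assumes f: "Ck_on k UNIV U f" and "j \<le> k"
  shows "Ck_on j UNIV U f"
proof -
  have "continuous_on U (iter_deriv f U hs)" if "length hs = j" for hs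
    using assms that differentiable_imp_continuous_on[of "iter_deriv f U hs" U]
    by (cases "j = k") (auto simp: Ck_on_def)
  with assms show ?thesis
    unfolding Ck_on_def by simp
qed

lemma Ck_on_directional_derivative:
  assumes f: "Ck_on k UNIV U f" "2 \<le> k" and U: "open U"
  shows "Ck_on 1 UNIV U (\<lambda>x. \<D> f x h)"
proof -
  define g where "g = iter_deriv f U [h]"
  have eq: "g x = \<D> f x h" if "x \<in> U" for x
    using that by (simp add: g_def at_within_open[OF _ U])
  have "g differentiable_on U"
    using f by (simp add: Ck_on_def g_def del: iter_deriv.simps(2))
  have cont: "continuous_on U (iter_deriv f U [h', h])" for h'
    using f differentiable_imp_continuous_on[of "iter_deriv f U [h', h]" U]
    by (cases "k = 2") (auto simp: Ck_on_def simp del: iter_deriv.simps(2))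
  have der: "((\<lambda>x. \<D> f x h) has_derivative \<D> g x) (at x)" if "x \<in> U" for x
  proof -
    have "g differentiable at x"
      using \<open>g differentiable_on U\<close> that by (simp add: differentiable_on_def at_within_open[OF _ U])
    then show ?thesis
      by (intro has_derivative_transform_within_open[OF _ U that eq] frechet_derivative_works[THEN iffD1])
  qed
  have "continuous_on U (\<lambda>x. \<D> (\<lambda>x. \<D> f x h) x h')" for h'
  proof -
    have "iter_deriv f U [h', h] x = \<D> (\<lambda>x. \<D> f x h) x h'" if "x \<in> U" for x
      using frechet_derivative_at[OF der[OF that]] that
      by (simp add: g_def at_within_open[OF _ U])
    then show ?thesis
      using cont[of h'] by (rule continuous_on_cong[OF refl, THEN iffD1])
  qed
  then show ?thesis
    unfolding Ck_on_one_iff[OF U] differentiable_def using der by blast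
qed

lemma C1_has_derivative:
  assumes "Ck_on 1 UNIV U f" "open U" "x \<in> U"
  shows "(f has_derivative \<D> f x) (at x)"
  using assms frechet_derivative_works Ck_on_one_iff by blast

lemma C1_derivative_linear:
  assumes "Ck_on 1 UNIV U f" "open U" "x \<in> U"
  shows "linear (\<D> f x)"
  using C1_has_derivative[OF assms] has_derivative_linear by blast

lemma linear_Basis_expansion:
  fixes L :: "'a::euclidean_space \<Rightarrow> 'b::real_vector"
  assumes "linear L"
  shows "L h = (\<Sum>e\<in>Basis. (h \<bullet> e) *\<^sub>R L e)"
proof -
  have "L h = L (\<Sum>e\<in>Basis. (h \<bullet> e) *\<^sub>R e)"
    by (simp add: euclidean_representation)
  then show ?thesis
    using assms by (simp add: linear_sum linear_cmul)
qed

lemma norm_sum_Basis_le: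
  fixes h :: "'a::euclidean_space" and L :: "'a \<Rightarrow> 'b::real_normed_vector"
  assumes "\<And>e. e \<in> Basis \<Longrightarrow> norm (L e) \<le> B"
  shows "norm (\<Sum>e\<in>Basis. (h \<bullet> e) *\<^sub>R L e) \<le> real DIM('a) * B * norm h"
proof -
  have "norm (\<Sum>e\<in>Basis. (h \<bullet> e) *\<^sub>R L e) \<le> (\<Sum>e\<in>(Basis::'a set). norm h * B)"
    by (rule sum_norm_le) (simp add: assms Basis_le_norm mult_mono)
  then show ?thesis
    by (simp add: mult.commute mult.left_commute)
qed

text \<open>
  Joint continuity of \<open>\<D> f x h\<close> in \<open>x\<close> and \<open>h\<close>. By linearity in \<open>h\<close> it reduces to the finitely many
  partial derivatives.
\<close>

lemma C1_derivative_tendsto: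
  assumes f: "Ck_on 1 UNIV U f" "open U" "p \<in> U"
    and g: "(g \<longlongrightarrow> p) F" and k: "(k \<longlongrightarrow> h) F"
  shows "((\<lambda>s. \<D> f (g s) (k s)) \<longlongrightarrow> \<D> f p h) F"
proof -
  have "((\<lambda>s. \<D> f (g s) e) \<longlongrightarrow> \<D> f p e) F" for e
  proof -
    have "isCont (\<lambda>x. \<D> f x e) p"
      using f Ck_on_one_iff[OF f(2), of f] continuous_on_eq_continuous_at[OF f(2)] by blast
    then show ?thesis
      using g isCont_tendsto_compose by blast
  qed
  then have "((\<lambda>s. \<Sum>e\<in>Basis. (k s \<bullet> e) *\<^sub>R \<D> f (g s) e) \<longlongrightarrow> (\<Sum>e\<in>Basis. (h \<bullet> e) *\<^sub>R \<D> f p e)) F"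
    by (intro tendsto_intros k)
  moreover have "eventually (\<lambda>s. (\<Sum>e\<in>Basis. (k s \<bullet> e) *\<^sub>R \<D> f (g s) e) = \<D> f (g s) (k s)) F"
    using topological_tendstoD[OF g f(2,3)]
    by eventually_elim (rule linear_Basis_expansion[OF C1_derivative_linear[OF f(1,2)], symmetric])
  ultimately show ?thesis
    by (subst linear_Basis_expansion[OF C1_derivative_linear[OF f], of h])
       (rule Lim_transform_eventually)
qed

lemma C1_derivative_near:
  fixes f :: "'a::euclidean_space \<Rightarrow> 'b::euclidean_space"
  assumes f: "Ck_on 1 UNIV U f" "open U" "p \<in> U" and "0 < \<epsilon>"
  shows "\<forall>\<^sub>F x in nhds p. x \<in> U \<and> (\<forall>h. norm (\<D> f x h - \<D> f p h) \<le> \<epsilon> * norm h)"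
proof -
  define B where "B = \<epsilon> / DIM('a)"
  have "0 < B" using \<open>0 < \<epsilon>\<close> by (simp add: B_def)
  have "\<forall>\<^sub>F x in nhds p. norm (\<D> f x e - \<D> f p e) \<le> B" for e
  proof -
    have "((\<lambda>x. \<D> f x e) \<longlongrightarrow> \<D> f p e) (nhds p)"
      using C1_derivative_tendsto[OF f, where g="\<lambda>x. x" and F="nhds p" and k="\<lambda>_. e" and h=e]
      by (simp add: filterlim_ident)
    then have "\<forall>\<^sub>F x in nhds p. dist (\<D> f x e) (\<D> f p e) < B"
      using \<open>0 < B\<close> tendstoD by blast
    then show ?thesis
      by eventually_elim (simp add: dist_norm)
  qed
  then have "\<forall>\<^sub>F x in nhds p. \<forall>e\<in>Basis. norm (\<D> f x e - \<D> f p e) \<le> B"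
    by (simp add: eventually_ball_finite_distrib)
  moreover have "\<forall>\<^sub>F x in nhds p. x \<in> U"
    using f by (simp add: eventually_nhds_in_open)
  ultimately show ?thesis
  proof eventually_elim
    case (elim x)
    have "norm (\<D> f x h - \<D> f p h) \<le> \<epsilon> * norm h" for h
    proof -
      have "linear (\<lambda>h. \<D> f x h - \<D> f p h)"
        using f elim by (intro linear_compose_sub C1_derivative_linear) simp_all
      from linear_Basis_expansion[OF this, of h] norm_sum_Basis_le[of "\<lambda>e. \<D> f x e - \<D> f p e" B h] elim
      show ?thesis by (simp add: B_def)
    qed
    with elim show ?case by blast
  qed
qed

lemma C1_strictly_differentiable:
  fixes f :: "'a::euclidean_space \<Rightarrow> 'b::euclidean_space"
  assumes f: "Ck_on 1 UNIV U f" "open U" "p \<in> U" and "0 < \<epsilon>"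
  obtains \<eta> where "0 < \<eta>" "ball p \<eta> \<subseteq> U"
    "\<And>x h. x \<in> ball p \<eta> \<Longrightarrow> norm (\<D> f x h - \<D> f p h) \<le> \<epsilon> * norm h"
    "\<And>x y. \<lbrakk>x \<in> ball p \<eta>; y \<in> ball p \<eta>\<rbrakk> \<Longrightarrow> norm (f y - f x - \<D> f p (y - x)) \<le> \<epsilon> * norm (y - x)"
proof -
  obtain \<eta> where "0 < \<eta>" and \<eta>: "\<And>x. dist x p < \<eta> \<Longrightarrow> x \<in> U"
    "\<And>x h. dist x p < \<eta> \<Longrightarrow> norm (\<D> f x h - \<D> f p h) \<le> \<epsilon> * norm h"
    using C1_derivative_near[OF assms] unfolding eventually_nhds_metric by blast
  have lin: "linear (\<D> f p)"
    using f by (rule C1_derivative_linear)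
  have "norm (f y - f x - \<D> f p (y - x)) \<le> \<epsilon> * norm (y - x)"
    if xy: "x \<in> ball p \<eta>" "y \<in> ball p \<eta>" for x y
  proof -
    have "norm ((f y - \<D> f p y) - (f x - \<D> f p x)) \<le> \<epsilon> * norm (y - x)"
    proof (rule differentiable_bound[where f'="\<lambda>z h. \<D> f z h - \<D> f p h" and S="ball p \<eta>"])
      fix z assume "z \<in> ball p \<eta>"
      then have "dist z p < \<eta>" by (simp add: dist_commute)
      show "((\<lambda>y. f y - \<D> f p y) has_derivative (\<lambda>h. \<D> f z h - \<D> f p h)) (at z within ball p \<eta>)"
        using f lin \<eta>(1)[OF \<open>dist z p < \<eta>\<close>]
        by (intro has_derivative_diff has_derivative_at_withinI[OF C1_has_derivative] linear_imp_has_derivative)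
      show "onorm (\<lambda>h. \<D> f z h - \<D> f p h) \<le> \<epsilon>"
        using \<eta>(2)[OF \<open>dist z p < \<eta>\<close>] by (rule onorm_le)
    qed (use xy in auto)
    then show ?thesis
      by (simp add: linear_diff[OF lin] algebra_simps)
  qed
  then show thesis
    using that[of \<eta>] \<open>0 < \<eta>\<close> \<eta> by (simp add: subset_iff dist_commute)
qed

text \<open>
  A second derivative is taken here as the derivative in direction \<open>k\<close> of the map \<open>\<lambda>z. \<D> f z h\<close>. The expansion
  shows that it is linear in the direction \<open>h\<close> of the inner derivative, too.
\<close>

lemma second_derivative_Basis_expansion:
  fixes f :: "'a::euclidean_space \<Rightarrow> 'b::euclidean_space"
  assumes f: "Ck_on 2 UNIV U f" and U: "open U" and x: "x \<in> U"
  shows "\<D> (\<lambda>z. \<D> f z h) x k = (\<Sum>e\<in>Basis. (h \<bullet> e) *\<^sub>R \<D> (\<lambda>z. \<D> f z e) x k)"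
proof -
  have C1: "Ck_on 1 UNIV U f" using Ck_on_mono[OF f] by simp
  have "((\<lambda>z. \<Sum>e\<in>Basis. (h \<bullet> e) *\<^sub>R \<D> f z e) has_derivative
      (\<lambda>k. \<Sum>e\<in>Basis. (h \<bullet> e) *\<^sub>R \<D> (\<lambda>z. \<D> f z e) x k)) (at x)"
    using C1_has_derivative[OF Ck_on_directional_derivative[OF f _ U] U x]
    by (intro has_derivative_sum has_derivative_scaleR_right) simp_all
  then have "((\<lambda>z. \<D> f z h) has_derivative
      (\<lambda>k. \<Sum>e\<in>Basis. (h \<bullet> e) *\<^sub>R \<D> (\<lambda>z. \<D> f z e) x k)) (at x)"
    by (rule has_derivative_transform_within_open[OF _ U x])
       (rule linear_Basis_expansion[OF C1_derivative_linear[OF C1 U], symmetric])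
  from fun_cong[OF frechet_derivative_at[OF this], of k] show ?thesis by (rule sym)
qed

lemma C2_second_derivative_near:
  fixes f :: "'a::euclidean_space \<Rightarrow> 'b::euclidean_space"
  assumes f: "Ck_on 2 UNIV U f" and U: "open U" and p: "p \<in> U" and "0 < \<epsilon>"
  obtains \<eta> where "0 < \<eta>"
    "\<And>x h. x \<in> ball p \<eta> \<Longrightarrow>
      norm (\<D> (\<lambda>z. \<D> f z h) x h - \<D> (\<lambda>z. \<D> f z h) p h) \<le> \<epsilon> * (norm h)\<^sup>2"
proof -
  define B where "B = \<epsilon> / DIM('a)"
  have "0 < B" using \<open>0 < \<epsilon>\<close> by (simp add: B_def)
  let ?D2 = "\<lambda>e x k. \<D> (\<lambda>z. \<D> f z e) x k"
  have "\<forall>\<^sub>F x in nhds p. \<forall>e\<in>Basis. x \<in> U \<and> (\<forall>k. norm (?D2 e x k - ?D2 e p k) \<le> B * norm k)"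
  proof (rule eventually_ball_finite[OF finite_Basis], rule ballI)
    show "\<forall>\<^sub>F x in nhds p. x \<in> U \<and> (\<forall>k. norm (?D2 e x k - ?D2 e p k) \<le> B * norm k)" for e
      using C1_derivative_near[OF Ck_on_directional_derivative[OF f order.refl U] U p \<open>0 < B\<close>] .
  qed
  then obtain \<eta> where \<eta>0: "0 < \<eta> \<and> (\<forall>x. dist x p < \<eta> \<longrightarrow>
      (\<forall>e\<in>Basis. x \<in> U \<and> (\<forall>k. norm (?D2 e x k - ?D2 e p k) \<le> B * norm k)))"
    unfolding eventually_nhds_metric by (rule exE)
  then have "0 < \<eta>" ..
  have \<eta>: "x \<in> U \<and> (\<forall>k. norm (?D2 e x k - ?D2 e p k) \<le> B * norm k)"
    if "dist x p < \<eta>" "e \<in> Basis" for x e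
    using conjunct2[OF \<eta>0, rule_format, OF that(1), rule_format, OF that(2)] .
  have sub: "x \<in> U" if "dist x p < \<eta>" for x
    using \<eta>[OF that SOME_Basis] ..
  have "norm (?D2 h x h - ?D2 h p h) \<le> \<epsilon> * (norm h)\<^sup>2" if "x \<in> ball p \<eta>" for x h
  proof -
    have x: "dist x p < \<eta>" using that by (simp add: dist_commute)
    have "?D2 h x h - ?D2 h p h = (\<Sum>e\<in>Basis. (h \<bullet> e) *\<^sub>R (?D2 e x h - ?D2 e p h))"
      using second_derivative_Basis_expansion[OF f U] sub[OF x] p
      by (simp add: scaleR_right_diff_distrib sum_subtractf)
    also have "norm \<dots> \<le> real DIM('a) * (B * norm h) * norm h"
      by (rule norm_sum_Basis_le) (rule \<eta>[OF x, THEN conjunct2, THEN spec])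
    finally show ?thesis by (simp add: B_def power2_eq_square)
  qed
  then show thesis
    using that[of \<eta>] \<open>0 < \<eta>\<close> by simp
qed

lemma C1_compose:
  fixes f :: "'a::euclidean_space \<Rightarrow> 'b::euclidean_space" and g :: "'b \<Rightarrow> 'c::euclidean_space"
  assumes g: "Ck_on 1 UNIV W g" "open W" and f: "Ck_on 1 UNIV U f" "open U" and sub: "f ` U \<subseteq> W"
  shows "Ck_on 1 UNIV U (\<lambda>x. g (f x))"
    and "x \<in> U \<Longrightarrow> \<D> (\<lambda>x. g (f x)) x h = \<D> g (f x) (\<D> f x h)"
proof -
  have der: "((\<lambda>x. g (f x)) has_derivative (\<lambda>h. \<D> g (f x) (\<D> f x h))) (at x)" if "x \<in> U" for x
  proof -
    have "f x \<in> W" using sub that by blast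
    from diff_chain_at[OF C1_has_derivative[OF f that] C1_has_derivative[OF g this]]
    show ?thesis by (simp add: o_def)
  qed
  have eq: "\<D> (\<lambda>x. g (f x)) x h = \<D> g (f x) (\<D> f x h)" if "x \<in> U" for x h
    using fun_cong[OF frechet_derivative_at[OF der[OF that]], of h] by (rule sym)
  then show "x \<in> U \<Longrightarrow> \<D> (\<lambda>x. g (f x)) x h = \<D> g (f x) (\<D> f x h)" .
  have "continuous_on U (\<lambda>x. \<D> g (f x) (\<D> f x h))" for h
    unfolding continuous_on_eq_continuous_at[OF f(2)] isCont_def
  proof
    fix x assume x: "x \<in> U"
    show "((\<lambda>x. \<D> g (f x) (\<D> f x h)) \<longlongrightarrow> \<D> g (f x) (\<D> f x h)) (at x)"
    proof (rule C1_derivative_tendsto[OF g])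
      show "f x \<in> W" using sub x by blast
      show "(f \<longlongrightarrow> f x) (at x)"
        using has_derivative_continuous[OF C1_has_derivative[OF f x]] by (simp add: isCont_def)
      show "((\<lambda>x. \<D> f x h) \<longlongrightarrow> \<D> f x h) (at x)"
        by (rule C1_derivative_tendsto[OF f x tendsto_ident_at tendsto_const])
    qed
  qed
  then have "continuous_on U (\<lambda>x. \<D> (\<lambda>x. g (f x)) x h)" for h
    by (simp only: continuous_on_cong[OF refl eq])
  then show "Ck_on 1 UNIV U (\<lambda>x. g (f x))"
    unfolding Ck_on_one_iff[OF f(2)] differentiable_def using der by blast
qed

lemma line_has_vector_derivative:
  assumes "(f has_derivative f') (at (z + s *\<^sub>R h))"
  shows "((\<lambda>s. f (z + s *\<^sub>R h)) has_vector_derivative f' h) (at s)"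
proof -
  have "((\<lambda>s. z + s *\<^sub>R h) has_vector_derivative h) (at s)"
    by (auto intro!: derivative_eq_intros)
  from vector_derivative_diff_chain_within[OF this has_derivative_at_withinI[OF assms]]
  show ?thesis by (simp add: o_def)
qed

text \<open>
  The mean value form of the remainder needs a real-valued function, hence the inner product with \<open>n\<close>.
\<close>

lemma C2_Taylor:
  fixes f :: "'a::euclidean_space \<Rightarrow> 'b::euclidean_space"
  assumes f: "Ck_on 2 UNIV U f" and U: "open U"
    and seg: "\<And>s. \<lbrakk>0 \<le> s; s \<le> 1\<rbrakk> \<Longrightarrow> x + s *\<^sub>R h \<in> U"
  obtains s where "0 < s" "s < 1"
    "(f (x + h) - f x) \<bullet> n = \<D> f x h \<bullet> n + (\<D> (\<lambda>z. \<D> f z h) (x + s *\<^sub>R h) h \<bullet> n) / 2"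
proof -
  define g where "g = (\<lambda>(m::nat) s. (if m = 0 then f (x + s *\<^sub>R h)
    else if m = 1 then \<D> f (x + s *\<^sub>R h) h
    else \<D> (\<lambda>z. \<D> f z h) (x + s *\<^sub>R h) h) \<bullet> n)"
  have C1: "Ck_on 1 UNIV U f" using Ck_on_mono[OF f] by simp
  have inner: "((\<lambda>s. k s \<bullet> n) has_real_derivative k' \<bullet> n) (at s)"
    if "(k has_vector_derivative k') (at s)" for k k' s
    using bounded_linear.has_vector_derivative[OF bounded_linear_inner_left that]
    by (simp add: has_real_derivative_iff_has_vector_derivative)
  have "\<exists>s>0. s < 1 \<and> g 0 1 = (\<Sum>m<(2::nat). g m 0 / fact m * (1 - 0) ^ m) + g 2 s / fact 2 * (1 - 0)\<^sup>2"
  proof (rule Taylor_up[where a=0])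
    show "\<forall>m s. m < 2 \<and> 0 \<le> s \<and> s \<le> 1 \<longrightarrow> (g m has_real_derivative g (Suc m) s) (at s)"
    proof (intro allI impI)
      fix m :: nat and s :: real assume ms: "m < 2 \<and> 0 \<le> s \<and> s \<le> 1"
      then have U': "x + s *\<^sub>R h \<in> U" by (simp add: seg)
      have "((\<lambda>s. f (x + s *\<^sub>R h)) has_vector_derivative \<D> f (x + s *\<^sub>R h) h) (at s)"
        by (rule line_has_vector_derivative[OF C1_has_derivative[OF C1 U U']])
      from inner[OF this] have 0: "(g 0 has_real_derivative g 1 s) (at s)"
        by (simp add: g_def)
      have "((\<lambda>s. \<D> f (x + s *\<^sub>R h) h) has_vector_derivative
          \<D> (\<lambda>z. \<D> f z h) (x + s *\<^sub>R h) h) (at s)"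
        by (rule line_has_vector_derivative[where f="\<lambda>z. \<D> f z h",
              OF C1_has_derivative[OF Ck_on_directional_derivative[OF f order.refl U] U U']])
      from inner[OF this] have 1: "(g 1 has_real_derivative g 2 s) (at s)"
        by (simp add: g_def)
      have "m = 0 \<or> m = 1" using ms by auto
      then show "(g m has_real_derivative g (Suc m) s) (at s)"
        using 0 1 by (auto simp: numeral_2_eq_2)
    qed
  qed simp_all
  then obtain s where s: "0 < s" "s < 1" "g 0 1 = g 0 0 + g 1 0 + g 2 s / 2"
    by (auto simp: numeral_2_eq_2)
  then show thesis
    using that[of s] by (simp add: g_def inner_diff_left)
qed

section \<open>Tangent spaces in a flattening chart\<close>

lemma has_vector_derivative_at_0_tendsto:
  assumes "(g has_vector_derivative w) (at 0)"
  shows "((\<lambda>s. (g s - g 0) /\<^sub>R s) \<longlongrightarrow> w) (at (0::real))"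
proof -
  have "((\<lambda>s. (g s - g 0 - s *\<^sub>R w) /\<^sub>R norm s) \<longlongrightarrow> 0) (at 0)"
    using assms unfolding has_vector_derivative_def has_derivative_at_within by simp
  then have "((\<lambda>s. norm ((g s - g 0 - s *\<^sub>R w) /\<^sub>R norm s)) \<longlongrightarrow> 0) (at 0)"
    by (rule tendsto_norm_zero)
  moreover have "norm ((g s - g 0 - s *\<^sub>R w) /\<^sub>R norm s) = norm ((g s - g 0) /\<^sub>R s - w)"
    if "s \<noteq> 0" for s
  proof -
    have "(g s - g 0) /\<^sub>R s - w = (g s - g 0 - s *\<^sub>R w) /\<^sub>R s"
      using that by (simp add: scaleR_right_diff_distrib)
    then show ?thesis by simp
  qed
  ultimately have "((\<lambda>s. norm ((g s - g 0) /\<^sub>R s - w)) \<longlongrightarrow> 0) (at 0)"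
    by (auto intro: Lim_transform_eventually simp: eventually_at_filter)
  then show ?thesis
    by (rule LIM_zero_cancel[OF tendsto_norm_zero_cancel])
qed

text \<open>
  The difference quotients stay in \<open>S\<close>, and \<open>S\<close> is closed.
\<close>

lemma vector_derivative_in_subspace:
  fixes g :: "real \<Rightarrow> 'a::euclidean_space"
  assumes "(g has_vector_derivative w) (at 0)" and S: "subspace S"
    and "\<forall>\<^sub>F s in nhds 0. g s \<in> S"
  shows "w \<in> S"
proof (rule Lim_in_closed_set[OF closed_subspace[OF S]])
  have "g 0 \<in> S" using assms(3) by (rule eventually_nhds_x_imp_x)
  then show "\<forall>\<^sub>F s in at 0. (g s - g 0) /\<^sub>R s \<in> S"
    unfolding eventually_at_filter using assms(3)
    by eventually_elim (simp add: S subspace_diff subspace_scale \<open>g 0 \<in> S\<close>)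
  show "((\<lambda>s. (g s - g 0) /\<^sub>R s) \<longlongrightarrow> w) (at 0)"
    using assms(1) by (rule has_vector_derivative_at_0_tendsto)
qed simp

text \<open>
  One of the charts in the definition of a submanifold, with the order of differentiability that
  second-order estimates use: two for the parametrization \<open>\<Psi>\<close>, and one for its inverse.
\<close>

locale flattening_chart =
  fixes M U W S :: "'a::euclidean_space set" and \<Phi> \<Psi> :: "'a \<Rightarrow> 'a"
  assumes open_U: "open U" and open_W: "open W" and homeo: "homeomorphism U W \<Phi> \<Psi>"
    and \<Phi>_C1: "Ck_on 1 UNIV U \<Phi>" and \<Psi>_C2: "Ck_on 2 UNIV W \<Psi>"
    and subspace: "subspace S" and flat: "\<Phi> ` (M \<inter> U) = W \<inter> S"
begin

lemma \<Psi>_\<Phi>: "x \<in> U \<Longrightarrow> \<Psi> (\<Phi> x) = x" and \<Phi>_\<Psi>: "z \<in> W \<Longrightarrow> \<Phi> (\<Psi> z) = z"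
  and \<Phi>_in: "x \<in> U \<Longrightarrow> \<Phi> x \<in> W" and \<Psi>_in: "z \<in> W \<Longrightarrow> \<Psi> z \<in> U"
  using homeo unfolding homeomorphism_def by blast+

lemma \<Phi>_in_S: "x \<in> M \<Longrightarrow> x \<in> U \<Longrightarrow> \<Phi> x \<in> S"
  using flat by blast

lemma \<Psi>_in_M: "z \<in> W \<Longrightarrow> z \<in> S \<Longrightarrow> \<Psi> z \<in> M"
  using flat \<Psi>_\<Phi> by (metis IntD1 IntI imageE IntD2)

lemma \<Psi>_C1: "Ck_on 1 UNIV W \<Psi>"
  by (rule Ck_on_mono[OF \<Psi>_C2]) simp

lemmas \<Phi>_derivative = C1_has_derivative[OF \<Phi>_C1 open_U]
lemmas \<Psi>_derivative = C1_has_derivative[OF \<Psi>_C1 open_W]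

lemma D\<Psi>_D\<Phi>:
  assumes "x \<in> U"
  shows "\<D> \<Psi> (\<Phi> x) (\<D> \<Phi> x v) = v"
proof -
  have "((\<Psi> \<circ> \<Phi>) has_derivative \<D> \<Psi> (\<Phi> x) \<circ> \<D> \<Phi> x) (at x)"
    using assms by (intro diff_chain_at \<Phi>_derivative \<Psi>_derivative \<Phi>_in)
  then have "((\<lambda>x. x) has_derivative \<D> \<Psi> (\<Phi> x) \<circ> \<D> \<Phi> x) (at x)"
    by (rule has_derivative_transform_within_open[OF _ open_U assms]) (simp add: \<Psi>_\<Phi>)
  from has_derivative_unique[OF this has_derivative_ident] show ?thesis
    by (simp add: fun_eq_iff)
qed

lemma D\<Phi>_D\<Psi>:
  assumes "z \<in> W"
  shows "\<D> \<Phi> (\<Psi> z) (\<D> \<Psi> z v) = v"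
proof -
  have "((\<Phi> \<circ> \<Psi>) has_derivative \<D> \<Phi> (\<Psi> z) \<circ> \<D> \<Psi> z) (at z)"
    using assms by (intro diff_chain_at \<Phi>_derivative \<Psi>_derivative \<Psi>_in)
  then have "((\<lambda>x. x) has_derivative \<D> \<Phi> (\<Psi> z) \<circ> \<D> \<Psi> z) (at z)"
    by (rule has_derivative_transform_within_open[OF _ open_W assms]) (simp add: \<Phi>_\<Psi>)
  from has_derivative_unique[OF this has_derivative_ident] show ?thesis
    by (simp add: fun_eq_iff)
qed

lemma line_in_W:
  assumes "z \<in> W"
  shows "\<forall>\<^sub>F s in nhds (0::real). z + s *\<^sub>R h \<in> W"
proof -
  have "((\<lambda>s. z + s *\<^sub>R h) \<longlongrightarrow> z + 0 *\<^sub>R h) (nhds 0)"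
    by (intro tendsto_intros filterlim_ident)
  then show ?thesis
    using topological_tendstoD[OF _ open_W, of "\<lambda>s. z + s *\<^sub>R h"] assms by simp
qed

lemma D\<Psi>_in_tangent_space:
  assumes z: "z \<in> W" "z \<in> S" and h: "h \<in> S"
  shows "\<D> \<Psi> z h \<in> tangent_space M (\<Psi> z)"
proof -
  let ?\<gamma> = "\<lambda>s. \<Psi> (z + s *\<^sub>R h)"
  obtain \<epsilon> where "0 < \<epsilon>" and W: "\<And>s::real. \<bar>s\<bar> < \<epsilon> \<Longrightarrow> z + s *\<^sub>R h \<in> W"
    using line_in_W[OF z(1), of h] unfolding eventually_nhds_metric by (auto simp: dist_real_def)
  have der: "(?\<gamma> has_vector_derivative \<D> \<Psi> (z + s *\<^sub>R h) h) (at s)" if "\<bar>s\<bar> < \<epsilon>" for s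
    using W[OF that] by (intro line_has_vector_derivative \<Psi>_derivative)
  have "continuous_on {-\<epsilon><..<\<epsilon>} (\<lambda>s. \<D> \<Psi> (z + s *\<^sub>R h) h)"
  proof (rule continuous_on_compose2[where t=W and g="\<lambda>x. \<D> \<Psi> x h"])
    show "continuous_on W (\<lambda>x. \<D> \<Psi> x h)"
      using \<Psi>_C1 Ck_on_one_iff[OF open_W, of \<Psi>] by blast
  qed (auto intro!: continuous_intros W)
  then have "?\<gamma> C1_differentiable_on {-\<epsilon><..<\<epsilon>}"
    using der unfolding C1_differentiable_on_def
    by (intro exI[of _ "\<lambda>s. \<D> \<Psi> (z + s *\<^sub>R h) h"]) auto
  moreover have "?\<gamma> ` {-\<epsilon><..<\<epsilon>} \<subseteq> M"
    using W z h subspace by (auto intro!: \<Psi>_in_M intro: subspace_add[OF subspace] subspace_scale[OF subspace])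
  ultimately show ?thesis
    using \<open>0 < \<epsilon>\<close> der[of 0] unfolding tangent_space_def
    by (intro CollectI exI[of _ ?\<gamma>] exI[of _ \<epsilon>]) simp
qed

text \<open>
  The tangent space is defined by curves in \<open>M\<close>. A curve through \<open>x\<close> is mapped by \<open>\<Phi>\<close> into \<open>S\<close>, and a vector of \<open>S\<close> is
  the velocity of a line in \<open>S\<close>, which \<open>\<Psi>\<close> maps to a curve in \<open>M\<close>. In particular the tangent space is a
  subspace.
\<close>

lemma tangent_space_eq:
  assumes x: "x \<in> M" "x \<in> U"
  shows "tangent_space M x = {v. \<D> \<Phi> x v \<in> S}"
proof (intro subset_antisym subsetI CollectI)
  fix v assume "v \<in> tangent_space M x"
  then obtain \<gamma> \<epsilon> where \<gamma>: "0 < \<epsilon>" "\<gamma> ` {-\<epsilon><..<\<epsilon>} \<subseteq> M" "\<gamma> 0 = x"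
    "(\<gamma> has_vector_derivative v) (at 0)"
    unfolding tangent_space_def by blast
  show "\<D> \<Phi> x v \<in> S"
  proof (rule vector_derivative_in_subspace[OF _ subspace])
    show "((\<Phi> \<circ> \<gamma>) has_vector_derivative \<D> \<Phi> x v) (at 0)"
      using vector_derivative_diff_chain_within[of \<gamma> v 0 UNIV \<Phi> "\<D> \<Phi> x"] \<gamma> x \<Phi>_derivative[of x]
      by (simp add: has_derivative_at_withinI)
    have "(\<gamma> \<longlongrightarrow> \<gamma> 0) (nhds 0)"
      using has_vector_derivative_continuous[OF \<gamma>(4)]
      by (simp add: continuous_at tendsto_at_iff_tendsto_nhds)
    then have "\<forall>\<^sub>F s in nhds 0. \<gamma> s \<in> U"
      using topological_tendstoD[OF _ open_U] \<gamma> x by blast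
    moreover have "\<forall>\<^sub>F s in nhds 0. s \<in> {-\<epsilon><..<\<epsilon>}"
      using \<gamma>(1) by (intro eventually_nhds_in_open) auto
    ultimately show "\<forall>\<^sub>F s in nhds 0. (\<Phi> \<circ> \<gamma>) s \<in> S"
      by eventually_elim (use \<gamma>(2) in \<open>auto intro!: \<Phi>_in_S\<close>)
  qed
next
  fix v assume "v \<in> {v. \<D> \<Phi> x v \<in> S}"
  then show "v \<in> tangent_space M x"
    using D\<Psi>_in_tangent_space[of "\<Phi> x" "\<D> \<Phi> x v"] x by (simp add: \<Phi>_in \<Phi>_in_S \<Psi>_\<Phi> D\<Psi>_D\<Phi>)
qed

lemma subspace_tangent_space:
  assumes x: "x \<in> M" "x \<in> U"
  shows "subspace (tangent_space M x)"
proof -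
  have "linear (\<D> \<Phi> x)"
    using \<Phi>_C1 open_U x(2) by (rule C1_derivative_linear)
  from linear_subspace_vimage[OF this subspace] show ?thesis
    by (simp add: tangent_space_eq[OF x] vimage_def)
qed

section \<open>The second fundamental form in a chart\<close>

text \<open>
  This makes the second fundamental form well defined: two tangent fields that agree at a point have
  derivatives that differ there by a tangent vector. Along a curve \<open>\<gamma>\<close> in \<open>M\<close> the vectors \<open>Y (\<gamma> s) / s\<close> are tangent at
  \<open>\<gamma> s\<close>, so \<open>\<D> \<Phi> (\<gamma> s)\<close> maps them into the closed set \<open>S\<close>; as \<open>Y\<close> vanishes at \<open>\<gamma> 0\<close>, they converge to the
  derivative of \<open>Y\<close> along \<open>\<gamma>\<close>.
\<close>

lemma vanishing_field_derivative_tangent: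
  assumes z: "z \<in> W" "z \<in> S" and h: "h \<in> S" and V: "open V" "\<Psi> z \<in> V"
    and der: "(Y has_derivative Y') (at (\<Psi> z))" and "Y (\<Psi> z) = 0"
    and tangent: "\<And>x. \<lbrakk>x \<in> M; x \<in> V\<rbrakk> \<Longrightarrow> Y x \<in> tangent_space M x"
  shows "Y' (\<D> \<Psi> z h) \<in> tangent_space M (\<Psi> z)"
proof -
  let ?\<gamma> = "\<lambda>s. \<Psi> (z + s *\<^sub>R h)"
  have \<gamma>: "(?\<gamma> has_vector_derivative \<D> \<Psi> z h) (at 0)"
    using z by (intro line_has_vector_derivative) (simp add: \<Psi>_derivative)
  have "(?\<gamma> \<longlongrightarrow> ?\<gamma> 0) (nhds 0)"
    using iffD1[OF tendsto_at_iff_tendsto_nhds[of ?\<gamma> 0]] has_vector_derivative_continuous[OF \<gamma>]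
    unfolding isCont_def by simp
  moreover have \<gamma>_at: "(?\<gamma> \<longlongrightarrow> \<Psi> z) (at 0)"
    using has_vector_derivative_continuous[OF \<gamma>] by (simp add: isCont_def)
  ultimately have \<gamma>_lim: "(?\<gamma> \<longlongrightarrow> \<Psi> z) (nhds 0)" by simp
  have "((Y \<circ> ?\<gamma>) has_vector_derivative Y' (\<D> \<Psi> z h)) (at 0)"
    by (rule vector_derivative_diff_chain_within[OF \<gamma>]) (simp add: der has_derivative_at_withinI)
  from has_vector_derivative_at_0_tendsto[OF this]
  have quot: "((\<lambda>s. Y (?\<gamma> s) /\<^sub>R s) \<longlongrightarrow> Y' (\<D> \<Psi> z h)) (at 0)"
    by (simp add: assms(7))
  have "\<D> \<Phi> (\<Psi> z) (Y' (\<D> \<Psi> z h)) \<in> S"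
  proof (rule Lim_in_closed_set[OF closed_subspace[OF subspace]])
    show "((\<lambda>s. \<D> \<Phi> (?\<gamma> s) (Y (?\<gamma> s) /\<^sub>R s)) \<longlongrightarrow> \<D> \<Phi> (\<Psi> z) (Y' (\<D> \<Psi> z h))) (at 0)"
      by (rule C1_derivative_tendsto[OF \<Phi>_C1 open_U \<Psi>_in[OF z(1)] \<gamma>_at quot])
    have "\<forall>\<^sub>F s in nhds 0. ?\<gamma> s \<in> V"
      using topological_tendstoD[OF \<gamma>_lim V] .
    then have "\<forall>\<^sub>F s in nhds 0. \<D> \<Phi> (?\<gamma> s) (Y (?\<gamma> s) /\<^sub>R s) \<in> S"
      using line_in_W[OF z(1), of h]
    proof eventually_elim
      case (elim s)
      have "z + s *\<^sub>R h \<in> S"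
        using z h by (intro subspace_add subspace_scale subspace)
      then have x: "?\<gamma> s \<in> M" "?\<gamma> s \<in> U"
        using elim by (simp_all add: \<Psi>_in_M \<Psi>_in)
      have "Y (?\<gamma> s) /\<^sub>R s \<in> tangent_space M (?\<gamma> s)"
        using tangent x elim by (intro subspace_scale subspace_tangent_space) simp_all
      then show ?case
        using x by (simp add: tangent_space_eq)
    qed
    then show "\<forall>\<^sub>F s in at 0. \<D> \<Phi> (?\<gamma> s) (Y (?\<gamma> s) /\<^sub>R s) \<in> S"
      unfolding eventually_at_filter by eventually_elim simp
  qed simp
  then show ?thesis
    using z by (simp add: tangent_space_eq \<Psi>_in_M \<Psi>_in)
qed

text \<open>
  On a tangent vector \<open>\<D> \<Psi> z h\<close> the second fundamental form is the normal part of the second derivative of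
  the curve \<open>\<Psi> (z + s h)\<close>. The field that is differentiated is the image \<open>\<D> \<Psi> (\<Phi> x) h\<close> of the constant field \<open>h\<close>.
\<close>

lemma second_fundamental_form_in_chart:
  assumes z: "z \<in> W" "z \<in> S" and h: "h \<in> S"
  defines "II \<equiv> second_fundamental_form M (\<Psi> z) (\<D> \<Psi> z h) (\<D> \<Psi> z h)"
  shows "II \<in> orthogonal_comp (tangent_space M (\<Psi> z))"
    and "\<D> (\<lambda>z. \<D> \<Psi> z h) z h - II \<in> tangent_space M (\<Psi> z)"
proof -
  let ?a = "\<Psi> z" let ?u = "\<D> \<Psi> z h" let ?T = "tangent_space M ?a"
  let ?D2 = "\<D> (\<lambda>z. \<D> \<Psi> z h) z h"
  define is_II where "is_II = (\<lambda>w. \<exists>U Y. open U \<and> ?a \<in> U \<and> Ck_on 1 UNIV U Y \<and>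
        (\<forall>x \<in> M \<inter> U. Y x \<in> tangent_space M x) \<and> Y ?a = ?u \<and>
        w \<in> orthogonal_comp ?T \<and> frechet_derivative Y (at ?a) ?u - w \<in> ?T)"
  have a: "?a \<in> M" "?a \<in> U" using z by (simp_all add: \<Psi>_in_M \<Psi>_in)
  have T: "subspace ?T" using a by (rule subspace_tangent_space)
  \<comment> \<open>The normal part \<open>w\<close> of the second derivative is the candidate value.\<close>
  obtain t w where "t \<in> span ?T" "\<And>v. v \<in> span ?T \<Longrightarrow> orthogonal w v" "?D2 = t + w"
    using orthogonal_subspace_decomp_exists by blast
  then have w: "w \<in> orthogonal_comp ?T" "?D2 - w \<in> ?T"
    unfolding span_eq_iff[THEN iffD2, OF T] by (simp_all add: orthogonal_comp_def orthogonal_commute)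
  let ?Y = "\<lambda>x. \<D> \<Psi> (\<Phi> x) h"
  have sub: "\<Phi> ` U \<subseteq> W" using \<Phi>_in by blast
  note dir = Ck_on_directional_derivative[OF \<Psi>_C2 order.refl open_W]
  have Y: "Ck_on 1 UNIV U ?Y" "\<D> ?Y ?a ?u = ?D2"
    using C1_compose[OF dir open_W \<Phi>_C1 open_U sub] z a by (simp_all add: \<Phi>_\<Psi> D\<Phi>_D\<Psi>)
  have Y_tangent: "?Y x \<in> tangent_space M x" if "x \<in> M" "x \<in> U" for x
    using D\<Psi>_in_tangent_space[of "\<Phi> x" h] that h by (simp add: \<Phi>_in \<Phi>_in_S \<Psi>_\<Phi>)
  have "is_II w"
    unfolding is_II_def using open_U a Y Y_tangent w z
    by (intro exI[of _ U] exI[of _ ?Y]) (simp add: \<Phi>_\<Psi>)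
  moreover have "w' = w" if II_w': "is_II w'" for w'
  proof -
    obtain V X where VX: "open V \<and> ?a \<in> V \<and> Ck_on 1 UNIV V X \<and>
        (\<forall>x \<in> M \<inter> V. X x \<in> tangent_space M x) \<and> X ?a = ?u \<and>
        w' \<in> orthogonal_comp ?T \<and> \<D> X ?a ?u - w' \<in> ?T"
      using II_w' unfolding is_II_def by (elim exE)
    then have V: "open V" "?a \<in> V" and X: "Ck_on 1 UNIV V X" "X ?a = ?u"
      and X_tangent: "\<And>x. \<lbrakk>x \<in> M; x \<in> V\<rbrakk> \<Longrightarrow> X x \<in> tangent_space M x"
      and w': "w' \<in> orthogonal_comp ?T" "\<D> X ?a ?u - w' \<in> ?T"
      by simp_all
    have "\<D> X ?a ?u - \<D> ?Y ?a ?u \<in> ?T"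
    proof (rule vanishing_field_derivative_tangent[OF z h open_Int[OF open_U V(1)],
        where Y="\<lambda>x. X x - ?Y x" and Y'="\<lambda>v. \<D> X ?a v - \<D> ?Y ?a v"])
      show "((\<lambda>x. X x - ?Y x) has_derivative (\<lambda>v. \<D> X ?a v - \<D> ?Y ?a v)) (at ?a)"
        by (intro has_derivative_diff C1_has_derivative[OF X(1) V] C1_has_derivative[OF Y(1) open_U a(2)])
      show "X x - ?Y x \<in> tangent_space M x" if "x \<in> M" "x \<in> U \<inter> V" for x
        using that by (intro subspace_diff subspace_tangent_space X_tangent Y_tangent) simp_all
    qed (use a V X z in \<open>simp_all add: \<Phi>_\<Psi>\<close>)
    then have "w' - w \<in> ?T"
      using subspace_diff[OF T subspace_add[OF T _ w(2)] w'(2), of "\<D> X ?a ?u - \<D> ?Y ?a ?u"]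
      by (simp add: Y(2) algebra_simps)
    moreover have "w' - w \<in> orthogonal_comp ?T"
      using w w' by (intro subspace_diff subspace_orthogonal_comp)
    ultimately have "orthogonal (w' - w) (w' - w)"
      by (simp add: orthogonal_comp_def)
    then show ?thesis by (simp add: orthogonal_self)
  qed
  ultimately have "(THE w. is_II w) = w" by (rule the_equality)
  then have "II = w"
    by (simp add: II_def second_fundamental_form_def is_II_def)
  with w show "II \<in> orthogonal_comp ?T" "?D2 - II \<in> ?T" by simp_all
qed

text \<open>
  The norm of the second fundamental form is a supremum over vectors of norm at most one, so the
  estimate is first obtained for \<open>h\<close> with a unit image and then scaled quadratically.
\<close>

lemma second_derivative_normal_bound:
  assumes z: "z \<in> W" "z \<in> S" and h: "h \<in> S"
    and K: "second_fundamental_form_onorm M (\<Psi> z) \<le> ereal K"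
    and n: "n \<in> orthogonal_comp (tangent_space M (\<Psi> z))"
  shows "\<D> (\<lambda>z. \<D> \<Psi> z h) z h \<bullet> n \<le> K * (norm (\<D> \<Psi> z h))\<^sup>2 * norm n"
proof -
  have lin: "linear (\<D> \<Psi> z)"
    using \<Psi>_C1 open_W z(1) by (rule C1_derivative_linear)
  have lin2: "linear (\<D> (\<lambda>z. \<D> \<Psi> z k) z)" for k
    by (rule C1_derivative_linear[OF Ck_on_directional_derivative[OF \<Psi>_C2 order.refl open_W] open_W z(1)])
  have unit: "\<D> (\<lambda>z. \<D> \<Psi> z k) z k \<bullet> n \<le> K * norm n"
    if k: "k \<in> S" and u: "norm (\<D> \<Psi> z k) = 1" for k
  proof -
    let ?II = "second_fundamental_form M (\<Psi> z) (\<D> \<Psi> z k) (\<D> \<Psi> z k)"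
    have "ereal (norm ?II) \<le> second_fundamental_form_onorm M (\<Psi> z)"
      unfolding second_fundamental_form_onorm_def
      using D\<Psi>_in_tangent_space[OF z k] u
      by (intro SUP_upper2[of "(\<D> \<Psi> z k, \<D> \<Psi> z k)"]) simp_all
    with K have "norm ?II \<le> K" by (meson ereal_less_eq(3) order_trans)
    have "(\<D> (\<lambda>z. \<D> \<Psi> z k) z k - ?II) \<bullet> n = 0"
      using second_fundamental_form_in_chart(2)[OF z k] n
      by (simp add: orthogonal_comp_def orthogonal_def)
    then have "\<D> (\<lambda>z. \<D> \<Psi> z k) z k \<bullet> n = ?II \<bullet> n"
      by (simp add: inner_diff_left)
    also have "\<dots> \<le> norm ?II * norm n" by (rule norm_cauchy_schwarz)
    also have "\<dots> \<le> K * norm n" using \<open>norm ?II \<le> K\<close> by (rule mult_right_mono) simp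
    finally show ?thesis .
  qed
  show ?thesis
  proof (cases "h = 0")
    case True
    then show ?thesis using linear_0[OF lin] linear_0[OF lin2] by simp
  next
    case False
    define c where "c = norm (\<D> \<Psi> z h)"
    have "\<D> \<Psi> z h \<noteq> 0"
      using D\<Phi>_D\<Psi>[OF z(1), of h] D\<Phi>_D\<Psi>[OF z(1), of 0] linear_0[OF lin] False by metis
    then have "0 < c" by (simp add: c_def)
    have "\<D> (\<lambda>z. \<D> \<Psi> z (h /\<^sub>R c)) z k = \<D> (\<lambda>z. \<D> \<Psi> z h) z k /\<^sub>R c" for k
      using second_derivative_Basis_expansion[OF \<Psi>_C2 open_W z(1), of "h /\<^sub>R c" k]
        second_derivative_Basis_expansion[OF \<Psi>_C2 open_W z(1), of h k]
      by (simp add: scaleR_sum_right)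
    then have "(\<D> (\<lambda>z. \<D> \<Psi> z h) z h /\<^sub>R c /\<^sub>R c) \<bullet> n \<le> K * norm n"
      using unit[of "h /\<^sub>R c"] h \<open>0 < c\<close>
      by (simp add: subspace_scale[OF subspace] linear_cmul[OF lin] linear_cmul[OF lin2] c_def)
    then show ?thesis
      using \<open>0 < c\<close> by (simp add: c_def[symmetric] field_simps power2_eq_square)
  qed
qed

end

section \<open>Tangent balls and the local estimate\<close>

text \<open>
  The squared distance from \<open>y\<close> along a curve in \<open>M\<close> through \<open>p\<close> is minimal at \<open>p\<close>.
\<close>

lemma nearest_point_normal:
  assumes "p \<in> M" and nearest: "\<And>q. q \<in> M \<Longrightarrow> dist y p \<le> dist y q"
  shows "y - p \<in> orthogonal_comp (tangent_space M p)"
  unfolding orthogonal_comp_def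
proof (intro CollectI ballI)
  fix v assume "v \<in> tangent_space M p"
  then obtain \<gamma> \<epsilon> where \<gamma>: "0 < \<epsilon>" "\<gamma> ` {-\<epsilon><..<\<epsilon>} \<subseteq> M" "\<gamma> 0 = p"
    "(\<gamma> has_vector_derivative v) (at 0)"
    unfolding tangent_space_def by blast
  have "((\<lambda>s. (y - \<gamma> s) \<bullet> (y - \<gamma> s)) has_derivative
      (\<lambda>s. (y - \<gamma> 0) \<bullet> (0 - s *\<^sub>R v) + (0 - s *\<^sub>R v) \<bullet> (y - \<gamma> 0))) (at 0)"
    using \<gamma>(4) unfolding has_vector_derivative_def
    by (intro has_derivative_inner has_derivative_diff has_derivative_const)
  then have "((\<lambda>s. (y - \<gamma> s) \<bullet> (y - \<gamma> s)) has_real_derivative - 2 * ((y - p) \<bullet> v)) (at 0)"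
    unfolding has_field_derivative_def
    by (rule has_derivative_eq_rhs) (simp add: fun_eq_iff \<gamma>(3) inner_commute)
  moreover have "(y - \<gamma> 0) \<bullet> (y - \<gamma> 0) \<le> (y - \<gamma> s) \<bullet> (y - \<gamma> s)" if "\<bar>0 - s\<bar> < \<epsilon>" for s
  proof -
    have "s \<in> {-\<epsilon><..<\<epsilon>}" using that by auto
    then have "\<gamma> s \<in> M" using \<gamma>(2) by blast
    then have "norm (y - \<gamma> 0) \<le> norm (y - \<gamma> s)" using nearest \<gamma>(3) by (simp add: dist_norm)
    then show ?thesis by (simp add: dot_square_norm power_mono)
  qed
  ultimately have "- 2 * ((y - p) \<bullet> v) = 0"
    using DERIV_local_min \<gamma>(1) by blast
  then show "orthogonal v (y - p)" by (simp add: orthogonal_def inner_commute)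
qed

text \<open>
  For a unit normal \<open>n\<close> at \<open>a\<close> the inequality says that \<open>b\<close> is outside the open ball of radius \<open>R\<close> and centre
  \<open>a + R n\<close>. The form without a centre is homogeneous in \<open>n\<close>, so normal vectors need not be normalized.
\<close>

definition avoids_tangent_balls :: "real \<Rightarrow> 'a::euclidean_space set \<Rightarrow> 'a \<Rightarrow> 'a \<Rightarrow> bool" where
  "avoids_tangent_balls R M a b \<longleftrightarrow>
     (\<forall>n\<in>orthogonal_comp (tangent_space M a). 2 * R * ((b - a) \<bullet> n) \<le> norm n * (norm (b - a))\<^sup>2)"

context flattening_chart
begin

text \<open>
  In the chart put \<open>\<alpha> = \<Phi> a\<close> and \<open>h = \<Phi> b - \<Phi> a\<close>. The first-order term of the expansion of \<open>b - a\<close> is tangent at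
  \<open>a\<close>, hence orthogonal to \<open>n\<close>, and the second-order term is close to the value of the second fundamental
  form on \<open>\<D> \<Psi> \<alpha> h\<close>, which is close to \<open>b - a\<close>. The errors are uniform near \<open>p\<close> and of the order \<open>\<epsilon> |h|\<^sup>2\<close>,
  and \<open>|h|\<close> is at most a multiple of \<open>|b - a|\<close>, so the slack between \<open>K\<close> and \<open>\<kappa>\<close> absorbs them.
\<close>

lemma tangent_height_bound:
  assumes p: "p \<in> M" "p \<in> U"
    and K: "\<And>a. a \<in> M \<Longrightarrow> second_fundamental_form_onorm M a \<le> ereal K" and "0 \<le> K" "K < \<kappa>"
  obtains \<eta> where "0 < \<eta>"
    "\<And>a b n. \<lbrakk>a \<in> M; a \<in> ball p \<eta>; b \<in> M; b \<in> ball p \<eta>; n \<in> orthogonal_comp (tangent_space M a)\<rbrakk>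
      \<Longrightarrow> 2 * ((b - a) \<bullet> n) \<le> \<kappa> * (norm n * (norm (b - a))\<^sup>2)"
proof -
  obtain C where "0 < C" and C: "\<And>v. norm (\<D> \<Phi> p v) \<le> C * norm v"
    using linear_bounded_pos[OF C1_derivative_linear[OF \<Phi>_C1 open_U p(2)]] by blast
  \<comment> \<open>The constant that the estimate below yields; \<open>C + 1\<close> is a Lipschitz constant of \<open>\<Phi>\<close> near \<open>p\<close>.\<close>
  define bound where "bound = (\<lambda>\<epsilon>::real. K * (1 + 2 * \<epsilon> * (C + 1))\<^sup>2 + 2 * \<epsilon> * (C + 1)\<^sup>2)"
  have "(bound \<longlongrightarrow> K * (1 + 2 * 0 * (C + 1))\<^sup>2 + 2 * 0 * (C + 1)\<^sup>2) (at_right 0)"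
    unfolding bound_def by (intro tendsto_intros)
  then have "\<forall>\<^sub>F \<epsilon> in at_right 0. bound \<epsilon> < \<kappa>"
    using \<open>K < \<kappa>\<close> by (intro order_tendstoD(2)) simp_all
  moreover have "\<forall>\<^sub>F \<epsilon> in at_right 0. 0 < (\<epsilon>::real)"
    by (rule eventually_at_right_less)
  ultimately have "\<forall>\<^sub>F \<epsilon> in at_right 0. bound \<epsilon> < \<kappa> \<and> 0 < \<epsilon>"
    by eventually_elim simp
  then obtain \<epsilon> where \<epsilon>: "bound \<epsilon> < \<kappa>" "0 < \<epsilon>"
    using eventually_happens'[OF trivial_limit_at_right_real] by blast
  let ?z = "\<Phi> p"
  let ?D2 = "\<lambda>z h. \<D> (\<lambda>z. \<D> \<Psi> z h) z h"
  have z: "?z \<in> W" using p by (simp add: \<Phi>_in)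
  obtain \<eta>1 where \<eta>1: "0 < \<eta>1" "ball ?z \<eta>1 \<subseteq> W"
    "\<And>x h. x \<in> ball ?z \<eta>1 \<Longrightarrow> norm (\<D> \<Psi> x h - \<D> \<Psi> ?z h) \<le> \<epsilon> * norm h"
    "\<And>x y. \<lbrakk>x \<in> ball ?z \<eta>1; y \<in> ball ?z \<eta>1\<rbrakk> \<Longrightarrow>
      norm (\<Psi> y - \<Psi> x - \<D> \<Psi> ?z (y - x)) \<le> \<epsilon> * norm (y - x)"
    using C1_strictly_differentiable[OF \<Psi>_C1 open_W z \<epsilon>(2)] by metis
  obtain \<eta>2 where \<eta>2: "0 < \<eta>2"
    "\<And>x h. x \<in> ball ?z \<eta>2 \<Longrightarrow> norm (?D2 x h - ?D2 ?z h) \<le> \<epsilon> * (norm h)\<^sup>2"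
    using C2_second_derivative_near[OF \<Psi>_C2 open_W z \<epsilon>(2)] by metis
  obtain \<eta>3 where \<eta>3: "0 < \<eta>3" "ball p \<eta>3 \<subseteq> U"
    "\<And>x y. \<lbrakk>x \<in> ball p \<eta>3; y \<in> ball p \<eta>3\<rbrakk> \<Longrightarrow>
      norm (\<Phi> y - \<Phi> x - \<D> \<Phi> p (y - x)) \<le> 1 * norm (y - x)"
    using C1_strictly_differentiable[OF \<Phi>_C1 open_U p(2) zero_less_one] by metis
  define r where "r = min \<eta>1 \<eta>2"
  define \<eta> where "\<eta> = min \<eta>3 (r / (C + 1))"
  have "0 < r" "0 < \<eta>" using \<eta>1 \<eta>2 \<eta>3 \<open>0 < C\<close> by (simp_all add: r_def \<eta>_def)
  have \<Phi>_Lipschitz: "norm (\<Phi> y - \<Phi> x) \<le> (C + 1) * norm (y - x)"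
    if "x \<in> ball p \<eta>" "y \<in> ball p \<eta>" for x y
  proof -
    have "norm (\<Phi> y - \<Phi> x) \<le> norm (\<D> \<Phi> p (y - x)) + norm (\<Phi> y - \<Phi> x - \<D> \<Phi> p (y - x))"
      using norm_triangle_ineq[of "\<D> \<Phi> p (y - x)" "\<Phi> y - \<Phi> x - \<D> \<Phi> p (y - x)"] by simp
    also have "\<dots> \<le> C * norm (y - x) + 1 * norm (y - x)"
      using that by (intro add_mono C \<eta>3) (simp_all add: \<eta>_def)
    finally show ?thesis by (simp add: algebra_simps)
  qed
  have "2 * ((b - a) \<bullet> n) \<le> \<kappa> * (norm n * (norm (b - a))\<^sup>2)"
    if a: "a \<in> M" "a \<in> ball p \<eta>" and b: "b \<in> M" "b \<in> ball p \<eta>"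
      and n: "n \<in> orthogonal_comp (tangent_space M a)" for a b n
  proof -
    have aU: "a \<in> U" and bU: "b \<in> U" using a b \<eta>3(2) by (auto simp: \<eta>_def)
    have near: "\<Phi> x \<in> ball ?z r" if "x \<in> ball p \<eta>" for x
    proof -
      have "norm (\<Phi> x - \<Phi> p) \<le> (C + 1) * norm (x - p)"
        using \<Phi>_Lipschitz[of p x] that \<open>0 < \<eta>\<close> by simp
      also have "\<dots> < (C + 1) * (r / (C + 1))"
        using that \<open>0 < C\<close> by (intro mult_strict_left_mono) (simp_all add: \<eta>_def dist_norm norm_minus_commute)
      finally show ?thesis using \<open>0 < C\<close> by (simp add: dist_norm norm_minus_commute)
    qed
    define \<alpha> h where "\<alpha> = \<Phi> a" and "h = \<Phi> b - \<Phi> a"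
    have \<alpha>: "\<alpha> \<in> W" "\<alpha> \<in> S" "\<Psi> \<alpha> = a" "\<alpha> \<in> ball ?z r"
      using a aU near by (simp_all add: \<alpha>_def \<Phi>_in \<Phi>_in_S \<Psi>_\<Phi>)
    have \<beta>: "\<Psi> (\<alpha> + h) = b" "\<alpha> + h \<in> ball ?z r"
      using b bU near by (simp_all add: \<alpha>_def h_def \<Psi>_\<Phi>)
    have h: "h \<in> S"
      using a b aU bU by (auto simp: h_def intro!: subspace_diff[OF subspace] \<Phi>_in_S)
    have h_le: "norm h \<le> (C + 1) * norm (b - a)"
      using \<Phi>_Lipschitz a b by (simp add: h_def)
    have seg: "\<alpha> + s *\<^sub>R h \<in> ball ?z r" if "0 \<le> s" "s \<le> 1" for s
    proof -
      have "(1 - s) *\<^sub>R \<alpha> + s *\<^sub>R (\<alpha> + h) \<in> ball ?z r"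
        using that \<alpha> \<beta> by (intro convexD convex_ball) simp_all
      then show ?thesis by (simp add: algebra_simps)
    qed
    have "\<alpha> + s *\<^sub>R h \<in> W" if "0 \<le> s" "s \<le> 1" for s
      using seg[OF that] \<eta>1(2) by (auto simp: r_def)
    then obtain s where s: "0 < s" "s < 1"
      and Taylor: "(\<Psi> (\<alpha> + h) - \<Psi> \<alpha>) \<bullet> n = \<D> \<Psi> \<alpha> h \<bullet> n + (?D2 (\<alpha> + s *\<^sub>R h) h \<bullet> n) / 2"
      using C2_Taylor[OF \<Psi>_C2 open_W, of \<alpha> h n] by metis
    have "\<D> \<Psi> \<alpha> h \<bullet> n = 0"
      using D\<Psi>_in_tangent_space[OF \<alpha>(1,2) h] n by (simp add: \<alpha>(3) orthogonal_comp_def orthogonal_def)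
    with Taylor have "2 * ((b - a) \<bullet> n) = ?D2 \<alpha> h \<bullet> n + (?D2 (\<alpha> + s *\<^sub>R h) h - ?D2 \<alpha> h) \<bullet> n"
      by (simp add: \<alpha>(3) \<beta>(1) inner_diff_left)
    also have "\<dots> \<le> K * (norm (\<D> \<Psi> \<alpha> h))\<^sup>2 * norm n + norm (?D2 (\<alpha> + s *\<^sub>R h) h - ?D2 \<alpha> h) * norm n"
    proof (intro add_mono norm_cauchy_schwarz second_derivative_normal_bound[OF \<alpha>(1,2) h])
      show "second_fundamental_form_onorm M (\<Psi> \<alpha>) \<le> ereal K"
        "n \<in> orthogonal_comp (tangent_space M (\<Psi> \<alpha>))"
        using K a n by (simp_all add: \<alpha>(3))
    qed
    also have "\<dots> \<le> K * ((1 + 2 * \<epsilon> * (C + 1)) * norm (b - a))\<^sup>2 * norm n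
        + 2 * \<epsilon> * ((C + 1) * norm (b - a))\<^sup>2 * norm n"
    proof (intro add_mono mult_right_mono mult_left_mono power_mono)
      have "norm (?D2 (\<alpha> + s *\<^sub>R h) h - ?D2 \<alpha> h)
          \<le> norm (?D2 (\<alpha> + s *\<^sub>R h) h - ?D2 ?z h) + norm (?D2 \<alpha> h - ?D2 ?z h)"
        using dist_triangle2[of "?D2 (\<alpha> + s *\<^sub>R h) h" "?D2 \<alpha> h" "?D2 ?z h"] by (simp add: dist_norm)
      also have "\<dots> \<le> \<epsilon> * (norm h)\<^sup>2 + \<epsilon> * (norm h)\<^sup>2"
        using seg[of s] s \<alpha>(4) by (intro add_mono \<eta>2) (simp_all add: r_def)
      also have "\<dots> = 2 * \<epsilon> * (norm h)\<^sup>2" by simp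
      also have "\<dots> \<le> 2 * \<epsilon> * ((C + 1) * norm (b - a))\<^sup>2"
        using h_le \<epsilon>(2) by (intro mult_left_mono power_mono) simp_all
      finally show "norm (?D2 (\<alpha> + s *\<^sub>R h) h - ?D2 \<alpha> h) \<le> 2 * \<epsilon> * ((C + 1) * norm (b - a))\<^sup>2" .
      have "norm (\<D> \<Psi> \<alpha> h) \<le> norm (b - a) + norm (b - a - \<D> \<Psi> ?z h) + norm (\<D> \<Psi> \<alpha> h - \<D> \<Psi> ?z h)"
        using norm_triangle_ineq4[of "b - a" "b - a - \<D> \<Psi> ?z h"]
          norm_triangle_sub[of "\<D> \<Psi> \<alpha> h" "\<D> \<Psi> ?z h"] by simp
      also have "\<dots> \<le> norm (b - a) + \<epsilon> * norm h + \<epsilon> * norm h"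
        using \<eta>1(3)[of \<alpha> h] \<eta>1(4)[of \<alpha> "\<alpha> + h"] \<alpha>(3,4) \<beta> by (simp add: r_def)
      also have "\<dots> = norm (b - a) + 2 * \<epsilon> * norm h" by simp
      also have "\<dots> \<le> norm (b - a) + 2 * \<epsilon> * ((C + 1) * norm (b - a))"
        using h_le \<epsilon>(2) by (intro add_left_mono mult_left_mono) simp_all
      finally show "norm (\<D> \<Psi> \<alpha> h) \<le> (1 + 2 * \<epsilon> * (C + 1)) * norm (b - a)"
        by (simp add: algebra_simps)
    qed (use \<open>0 \<le> K\<close> in simp_all)
    also have "\<dots> = bound \<epsilon> * (norm n * (norm (b - a))\<^sup>2)"
      unfolding bound_def power_mult_distrib by algebra
    also have "\<dots> \<le> \<kappa> * (norm n * (norm (b - a))\<^sup>2)"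
      using \<epsilon>(1) by (intro mult_right_mono) simp_all
    finally show ?thesis .
  qed
  with that \<open>0 < \<eta>\<close> show thesis by blast
qed

end

text \<open>
  The scale \<open>h\<^sub>0\<close> is a Lebesgue number of the cover of \<open>M\<close> by the neighbourhoods of the preceding lemma.
\<close>

lemma submanifold_avoids_tangent_balls_locally:
  fixes M :: "'a::euclidean_space set"
  assumes "compact M" "submanifold k d M" "2 \<le> k"
    and K: "\<And>a. a \<in> M \<Longrightarrow> second_fundamental_form_onorm M a \<le> ereal K"
    and "0 \<le> K" "0 < R" "K * R < 1"
  obtains h\<^sub>0 where "0 < h\<^sub>0"
    "\<And>a b. \<lbrakk>a \<in> M; b \<in> M; dist a b < h\<^sub>0\<rbrakk> \<Longrightarrow> avoids_tangent_balls R M a b"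
proof -
  define good where "good = (\<lambda>G. \<forall>a\<in>M \<inter> G. \<forall>b\<in>M \<inter> G. avoids_tangent_balls R M a b)"
  have good_ball: "\<exists>\<eta>>0. good (ball p \<eta>)" if p: "p \<in> M" for p
  proof -
    obtain U W \<Phi> \<Psi> S where chart: "open U" "p \<in> U" "open W" "homeomorphism U W \<Phi> \<Psi>"
        "Ck_on k UNIV U \<Phi>" "Ck_on k UNIV W (\<Psi> :: 'a \<Rightarrow> 'a)"
        "subspace S" "\<Phi> ` (M \<inter> U) = W \<inter> S"
      using assms(2) p unfolding submanifold_def by metis
    interpret flattening_chart M U W S \<Phi> \<Psi>
      using chart \<open>2 \<le> k\<close> by unfold_locales (auto intro: Ck_on_mono)
    have "K < 1 / R"
      using \<open>K * R < 1\<close> \<open>0 < R\<close> by (simp add: pos_less_divide_eq)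
    then obtain \<eta> where "0 < \<eta>" and \<eta>: "\<And>a b n. \<lbrakk>a \<in> M; a \<in> ball p \<eta>; b \<in> M; b \<in> ball p \<eta>;
        n \<in> orthogonal_comp (tangent_space M a)\<rbrakk>
        \<Longrightarrow> 2 * ((b - a) \<bullet> n) \<le> 1 / R * (norm n * (norm (b - a))\<^sup>2)"
      using tangent_height_bound[OF p chart(2) K \<open>0 \<le> K\<close>] by metis
    have "good (ball p \<eta>)"
      unfolding good_def avoids_tangent_balls_def using \<eta> \<open>0 < R\<close> by (simp add: field_simps)
    with \<open>0 < \<eta>\<close> show ?thesis by blast
  qed
  have cover: "M \<subseteq> \<Union>{G. open G \<and> good G}"
  proof
    fix p assume "p \<in> M"
    then obtain \<eta> where "0 < \<eta>" "good (ball p \<eta>)" using good_ball by blast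
    then show "p \<in> \<Union>{G. open G \<and> good G}"
      by (intro UnionI[of "ball p \<eta>"]) simp_all
  qed
  obtain h\<^sub>0 where "0 < h\<^sub>0" and h\<^sub>0: "\<And>x. x \<in> M \<Longrightarrow> \<exists>G\<in>{G. open G \<and> good G}. ball x h\<^sub>0 \<subseteq> G"
  proof (rule Heine_Borel_lemma[OF \<open>compact M\<close> cover])
    show "open G" if "G \<in> {G. open G \<and> good G}" for G
      using that by simp
  qed (rule that)
  have "avoids_tangent_balls R M a b" if ab: "a \<in> M" "b \<in> M" "dist a b < h\<^sub>0" for a b
  proof -
    obtain G where "good G" "ball a h\<^sub>0 \<subseteq> G" using h\<^sub>0[OF ab(1)] by blast
    moreover have "a \<in> ball a h\<^sub>0" "b \<in> ball a h\<^sub>0" using ab \<open>0 < h\<^sub>0\<close> by auto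
    ultimately show ?thesis using ab unfolding good_def by blast
  qed
  with that \<open>0 < h\<^sub>0\<close> show thesis by blast
qed

section \<open>From local to global\<close>

text \<open>
  Here \<open>p\<close> is a point whose offset from the midpoint is normal, such as a nearest point. The hypotheses at
  \<open>p\<close> say that \<open>a\<close> and \<open>b\<close> avoid the tangent ball on the side of the midpoint, which bounds the offset by the
  sagitta \<open>R - sqrt (R\<^sup>2 - |a - b|\<^sup>2 / 4)\<close>. A ball of radius \<open>R\<close> that has \<open>a\<close> on its boundary and \<open>b\<close> in its interior
  contains the midpoint at a depth larger than the sagitta, and so contains \<open>p\<close>.
\<close>

lemma avoids_tangent_balls_midpoint:
  assumes R: "0 < R" "dist a b \<le> 2 * R"
    and near: "dist (midpoint a b) p \<le> dist a b / 2"
    and normal: "midpoint a b - p \<in> orthogonal_comp (tangent_space M p)"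
    and pa: "avoids_tangent_balls R M p a" and pb: "avoids_tangent_balls R M p b"
    and ap: "avoids_tangent_balls R M a p"
  shows "avoids_tangent_balls R M a b"
  unfolding avoids_tangent_balls_def
proof (intro ballI)
  fix \<nu> assume \<nu>: "\<nu> \<in> orthogonal_comp (tangent_space M a)"
  define m d where "m = midpoint a b" and "d = (1/2) *\<^sub>R (b - a)"
  define n where "n = m - p"
  have m: "m = a + d" "m = b - d"
    by (simp_all add: m_def d_def midpoint_def algebra_simps flip: scaleR_add_left)
  have d: "norm d = dist a b / 2"
    by (simp add: d_def dist_norm norm_minus_commute)
  have n_le: "norm n \<le> norm d" "norm d \<le> R"
    using near R d by (simp_all add: n_def m_def dist_norm)
  \<comment> \<open>Equivalent to the bound of \<open>norm n\<close> by the sagitta, since \<open>norm n \<le> R\<close>.\<close>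
  have sagitta: "2 * R * norm n \<le> (norm n)\<^sup>2 + (norm d)\<^sup>2"
  proof (cases "n = 0")
    case False
    have a: "a - p = n - d" by (simp add: n_def m(1))
    have b: "b - p = n + d" by (simp add: n_def m(2))
    have "2 * R * ((a - p) \<bullet> n) + 2 * R * ((b - p) \<bullet> n)
        \<le> norm n * (norm (a - p))\<^sup>2 + norm n * (norm (b - p))\<^sup>2"
      using pa pb normal unfolding avoids_tangent_balls_def n_def m_def by (intro add_mono) blast+
    also have "2 * R * ((a - p) \<bullet> n) + 2 * R * ((b - p) \<bullet> n) = norm n * (4 * R * norm n)"
      by (simp add: a b inner_diff_left inner_add_left dot_square_norm power2_eq_square algebra_simps)
    also have "norm n * (norm (a - p))\<^sup>2 + norm n * (norm (b - p))\<^sup>2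
        = norm n * (2 * (norm n)\<^sup>2 + 2 * (norm d)\<^sup>2)"
      by (simp add: a b power2_norm_eq_inner inner_diff_left inner_diff_right inner_add_left
          inner_add_right inner_commute algebra_simps)
    finally have "4 * R * norm n \<le> 2 * (norm n)\<^sup>2 + 2 * (norm d)\<^sup>2"
      by (rule mult_left_le_imp_le) (simp add: False)
    then show ?thesis by simp
  qed simp
  show "2 * R * ((b - a) \<bullet> \<nu>) \<le> norm \<nu> * (norm (b - a))\<^sup>2"
  proof (rule ccontr)
    assume neg: "\<not> ?thesis"
    then have "\<nu> \<noteq> 0" by auto
    \<comment> \<open>The centre of the tangent ball at \<open>a\<close> in direction \<open>\<nu>\<close>.\<close>
    define z where "z = a + (R / norm \<nu>) *\<^sub>R \<nu>"
    have expand: "(norm (w - c *\<^sub>R \<nu>))\<^sup>2 = (norm w)\<^sup>2 + c\<^sup>2 * (norm \<nu>)\<^sup>2 - 2 * c * (w \<bullet> \<nu>)" for w c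
      by (simp add: power2_norm_eq_inner inner_diff_left inner_diff_right inner_commute
          power2_eq_square[of c] algebra_simps)
    have dist_z: "(norm (x - z))\<^sup>2 = R\<^sup>2 + ((norm (x - a))\<^sup>2 - 2 * R * ((x - a) \<bullet> \<nu>) / norm \<nu>)" for x
    proof -
      have "(norm (x - z))\<^sup>2 = (norm ((x - a) - (R / norm \<nu>) *\<^sub>R \<nu>))\<^sup>2"
        by (simp add: z_def algebra_simps)
      also have "\<dots> = (norm (x - a))\<^sup>2 + (R / norm \<nu>)\<^sup>2 * (norm \<nu>)\<^sup>2 - 2 * (R / norm \<nu>) * ((x - a) \<bullet> \<nu>)"
        by (rule expand)
      finally show ?thesis using \<open>\<nu> \<noteq> 0\<close> by (simp add: power_divide)
    qed
    have b_in: "(norm (b - z))\<^sup>2 < R\<^sup>2"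
      using neg \<open>\<nu> \<noteq> 0\<close> by (simp add: dist_z field_simps)
    have p_out: "R\<^sup>2 \<le> (norm (p - z))\<^sup>2"
      using ap \<nu> \<open>\<nu> \<noteq> 0\<close> by (simp add: dist_z avoids_tangent_balls_def field_simps)
    have "(norm (a - z))\<^sup>2 = R\<^sup>2" by (simp add: dist_z)
    moreover have "(norm (a - z))\<^sup>2 + (norm (b - z))\<^sup>2 = 2 * (norm (m - z))\<^sup>2 + 2 * (norm d)\<^sup>2"
    proof -
      have a: "a - z = (m - z) - d" by (simp add: m(1))
      have b: "b - z = (m - z) + d" by (simp add: m(2))
      show ?thesis
        unfolding a b by (simp add: power2_norm_eq_inner inner_diff_left inner_diff_right inner_add_left
          inner_add_right inner_commute algebra_simps)
    qed
    ultimately have "(norm (m - z))\<^sup>2 < R\<^sup>2 - (norm d)\<^sup>2"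
      using b_in by simp
    also have "\<dots> \<le> (R - norm n)\<^sup>2"
      using sagitta by (simp add: power2_diff)
    finally have "norm (m - z) < R - norm n"
      by (rule power_less_imp_less_base) (use n_le in simp)
    moreover have "norm (p - z) \<le> norm (m - z) + norm n"
      using norm_triangle_ineq4[of "m - z" n] by (simp add: n_def)
    ultimately have "norm (p - z) < R" by simp
    then have "(norm (p - z))\<^sup>2 < R\<^sup>2" by (intro power_strict_mono) simp_all
    with p_out show False by simp
  qed
qed

text \<open>
  Induction on the scale. Among pairs at distance between \<open>h\<^sub>0\<close> and \<open>2 t\<close>, the distance of the midpoint from \<open>M\<close>
  is at most \<open>c\<close> times that of the pair for some \<open>c < 1/2\<close>: otherwise, by compactness, both points of some
  pair would be nearest to their midpoint, against uniqueness. Replacing a pair by one that contains the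
  point nearest to the midpoint thus multiplies the distance by at most \<open>1/2 + c < 1\<close>.
\<close>

lemma avoids_tangent_balls_global:
  fixes M :: "'a::euclidean_space set"
  assumes "compact M" and "0 < R" "t \<le> R" "t < \<delta>" "0 < h\<^sub>0"
    and unique: "\<And>x. infdist x M < \<delta> \<Longrightarrow> \<exists>!q. q \<in> M \<and> dist x q = infdist x M"
    and near: "\<And>a b. \<lbrakk>a \<in> M; b \<in> M; dist a b < h\<^sub>0\<rbrakk> \<Longrightarrow> avoids_tangent_balls R M a b"
    and ab: "a \<in> M" "b \<in> M" "dist a b \<le> 2 * t"
  shows "avoids_tangent_balls R M a b"
proof -
  let ?P = "{(a, b) \<in> M \<times> M. h\<^sub>0 \<le> dist a b \<and> dist a b \<le> 2 * t}"
  let ?g = "\<lambda>(a, b). infdist (midpoint a b) M / dist a b"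
  have g_less: "?g (a, b) < 1/2" if "(a, b) \<in> ?P" for a b
  proof -
    have ab: "a \<in> M" "b \<in> M" "0 < dist a b" "dist a b \<le> 2 * t" "a \<noteq> b"
      using that \<open>0 < h\<^sub>0\<close> by auto
    have le: "infdist (midpoint a b) M \<le> dist a b / 2"
      using infdist_le[OF ab(1), of "midpoint a b"] by (simp add: dist_midpoint)
    have "infdist (midpoint a b) M \<noteq> dist a b / 2"
    proof
      assume eq: "infdist (midpoint a b) M = dist a b / 2"
      with ab \<open>t < \<delta>\<close> have "infdist (midpoint a b) M < \<delta>" by simp
      moreover have "dist (midpoint a b) a = infdist (midpoint a b) M"
        "dist (midpoint a b) b = infdist (midpoint a b) M"
        by (simp_all add: eq dist_midpoint)
      ultimately show False using unique ab by blast
    qed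
    with le ab show ?thesis by (simp add: divide_less_eq)
  qed
  obtain c where c: "0 \<le> c" "c < 1/2"
    "\<And>a b. (a, b) \<in> ?P \<Longrightarrow> infdist (midpoint a b) M \<le> c * dist a b"
  proof (cases "?P = {}")
    case True
    then show ?thesis using that[of 0] by auto
  next
    case False
    have "?P = (M \<times> M) \<inter> {x. h\<^sub>0 \<le> dist (fst x) (snd x)} \<inter> {x. dist (fst x) (snd x) \<le> 2 * t}"
      by auto
    moreover have "closed {x::'a \<times> 'a. h\<^sub>0 \<le> dist (fst x) (snd x)}"
      "closed {x::'a \<times> 'a. dist (fst x) (snd x) \<le> 2 * t}"
      by (intro closed_Collect_le continuous_intros)+
    ultimately have "compact ?P"
      using \<open>compact M\<close> by (simp add: compact_Int_closed compact_Times)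
    moreover have "continuous_on ?P ?g"
      using \<open>0 < h\<^sub>0\<close> unfolding midpoint_def case_prod_unfold
      by (intro continuous_intros) auto
    ultimately obtain x where x: "x \<in> ?P" "\<And>y. y \<in> ?P \<Longrightarrow> ?g y \<le> ?g x"
      using continuous_attains_sup[of ?P ?g] False by blast
    show ?thesis
    proof (rule that[of "?g x"])
      show "0 \<le> ?g x" by (simp add: case_prod_unfold infdist_nonneg)
      show "?g x < 1/2" using g_less x(1) by (cases x) blast
      show "infdist (midpoint a b) M \<le> ?g x * dist a b" if "(a, b) \<in> ?P" for a b
      proof -
        have "0 < dist a b" using that \<open>0 < h\<^sub>0\<close> by auto
        then show ?thesis using x(2)[OF that] by (simp add: divide_le_eq)
      qed
    qed
  qed
  have "avoids_tangent_balls R M a b"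
    if "a \<in> M" "b \<in> M" "dist a b \<le> 2 * t" "(1/2 + c) ^ k * dist a b < h\<^sub>0" for k a b
    using that
  proof (induction k arbitrary: a b)
    case 0
    then show ?case by (simp add: near)
  next
    case (Suc k)
    show ?case
    proof (cases "dist a b < h\<^sub>0")
      case True
      with Suc.prems show ?thesis by (simp add: near)
    next
      case False
      obtain p where p: "p \<in> M" "infdist (midpoint a b) M = dist (midpoint a b) p"
        using infdist_attains_inf[of M "midpoint a b"] \<open>compact M\<close> \<open>a \<in> M\<close>
        by (auto simp: compact_imp_closed)
      have mp: "dist (midpoint a b) p \<le> c * dist a b"
        using c(3)[of a b] False Suc.prems p by simp
      have cd: "c * dist a b \<le> 1/2 * dist a b"
        using c by (intro mult_right_mono) simp_all
      have IH: "avoids_tangent_balls R M x y"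
        if "x \<in> M" "y \<in> M" "dist x y \<le> (1/2 + c) * dist a b" for x y
      proof (rule Suc.IH[OF that(1,2)])
        show "dist x y \<le> 2 * t"
          using that(3) cd Suc.prems(3) by (simp add: algebra_simps)
        have "(1/2 + c) ^ k * dist x y \<le> (1/2 + c) ^ k * ((1/2 + c) * dist a b)"
          using that(3) c by (intro mult_left_mono) simp_all
        then show "(1/2 + c) ^ k * dist x y < h\<^sub>0"
          using Suc.prems(4) by (simp add: mult.assoc mult.left_commute)
      qed
      have "dist p a \<le> (1/2 + c) * dist a b" "dist p b \<le> (1/2 + c) * dist a b"
        using mp dist_triangle[of p a "midpoint a b"] dist_triangle[of p b "midpoint a b"]
        by (simp_all add: dist_midpoint dist_commute algebra_simps)
      then have "avoids_tangent_balls R M p a" "avoids_tangent_balls R M p b" "avoids_tangent_balls R M a p"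
        using Suc.prems(1,2) p(1) by (simp_all add: IH dist_commute)
      moreover have "midpoint a b - p \<in> orthogonal_comp (tangent_space M p)"
        using p by (intro nearest_point_normal) (simp_all add: infdist_le flip: p(2))
      ultimately show ?thesis
        using \<open>0 < R\<close> \<open>t \<le> R\<close> Suc.prems(3) mp cd
        by - (rule avoids_tangent_balls_midpoint[where p=p], simp_all)
    qed
  qed
  moreover have "\<exists>k. (1/2 + c) ^ k * dist a b < h\<^sub>0"
  proof -
    have "(\<lambda>k. (1/2 + c) ^ k * dist a b) \<longlonglongrightarrow> 0 * dist a b"
      using c by (intro tendsto_mult_right LIMSEQ_power_zero) simp
    then have "\<forall>\<^sub>F k in sequentially. (1/2 + c) ^ k * dist a b < h\<^sub>0"
      using \<open>0 < h\<^sub>0\<close> by (intro order_tendstoD(2)) simp_all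
    then show ?thesis by (rule eventually_happens'[OF sequentially_bot])
  qed
  ultimately show ?thesis using ab by blast
qed

section \<open>Distance from the convex hull\<close>

text \<open>
  If all points of \<open>\<sigma>\<close> were farther than \<open>t\<close> from \<open>y\<close>, they would be nearer to \<open>c\<close> than to \<open>y\<close>. Then the half-space of
  the points with this property would contain the convex hull of \<open>\<sigma>\<close>, but it does not contain \<open>y\<close>.
\<close>

lemma infdist_convex_hull_le:
  fixes \<sigma> :: "'a::euclidean_space set"
  assumes "\<sigma> \<subseteq> X" "\<sigma> \<subseteq> cball c t" "y \<in> convex hull \<sigma>"
  shows "infdist y X \<le> t"
proof (rule ccontr)
  assume "\<not> infdist y X \<le> t"
  then have far: "t < dist y x" if "x \<in> \<sigma>" for x
    using infdist_le[of x X y] that assms(1) by force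
  have "(y - c) \<bullet> x < ((norm y)\<^sup>2 - (norm c)\<^sup>2) / 2"
    if "x \<in> \<sigma>" for x
  proof -
    have "norm (x - c) < norm (y - x)"
      using far[OF that] assms(2) that by (auto simp: dist_norm norm_minus_commute)
    then have "(norm (x - c))\<^sup>2 < (norm (y - x))\<^sup>2"
      by (intro power_strict_mono) simp_all
    then show ?thesis
      by (simp add: power2_norm_eq_inner inner_diff_left inner_diff_right inner_commute)
  qed
  then have "convex hull \<sigma> \<subseteq> {x. (y - c) \<bullet> x < ((norm y)\<^sup>2 - (norm c)\<^sup>2) / 2}"
    by (intro hull_minimal convex_halfspace_lt) auto
  then have "0 < - (norm (y - c))\<^sup>2"
    using assms(3)
    by (auto simp: power2_norm_eq_inner inner_diff_left inner_diff_right inner_commute)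
  then show False by simp
qed

text \<open>
  With \<open>n = y - q\<close>, the conditions that \<open>x\<close> is in \<open>cball c t\<close> and avoids the tangent ball at \<open>q\<close> in direction \<open>n\<close>
  combine to an inequality in which the terms quadratic in \<open>x\<close> cancel, so that it extends from \<open>\<sigma>\<close> to the
  convex hull. At \<open>y\<close>, after division by \<open>r > 0\<close>, it reads
  \<open>2 R r \<le> t\<^sup>2 + r\<^sup>2 - |y - c|\<^sup>2\<close>. For \<open>t \<le> R\<close> it also gives \<open>|y - c| \<le> t - r\<close>, hence
  the second conclusion.
\<close>

lemma foot_point_bound:
  fixes \<sigma> :: "'a::euclidean_space set"
  assumes \<sigma>: "\<sigma> \<subseteq> cball c t" "y \<in> convex hull \<sigma>" and "t \<le> R"
    and q: "q \<in> M" "dist y q = infdist y M" "infdist y M \<le> t"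
    and avoid: "\<And>x. x \<in> \<sigma> \<Longrightarrow> avoids_tangent_balls R M q x"
  shows "2 * R * infdist y M \<le> t\<^sup>2 + (infdist y M)\<^sup>2" and "dist c q \<le> t"
proof -
  define n r where "n = y - q" and "r = infdist y M"
  have r: "norm n = r" "0 \<le> r" "r \<le> t"
    using q by (simp_all add: n_def r_def dist_norm infdist_nonneg)
  have normal: "n \<in> orthogonal_comp (tangent_space M q)"
    unfolding n_def using q by (intro nearest_point_normal) (simp_all add: infdist_le)
  have "r * (2 * R * r) \<le> r * (t\<^sup>2 + r\<^sup>2 - (norm (y - c))\<^sup>2)"
  proof -
    have "((2 * R) *\<^sub>R n - (2 * r) *\<^sub>R (c - q)) \<bullet> x
        \<le> 2 * R * (q \<bullet> n) + r * (t\<^sup>2 + (norm q)\<^sup>2 - (norm c)\<^sup>2)" if "x \<in> \<sigma>" for x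
    proof -
      have "2 * R * ((x - q) \<bullet> n) \<le> r * (norm (x - q))\<^sup>2"
        using avoid[OF that] normal r by (auto simp: avoids_tangent_balls_def)
      moreover have "norm (x - c) \<le> t"
        using \<sigma>(1) that by (auto simp: dist_norm norm_minus_commute)
      then have "r * (norm (x - c))\<^sup>2 \<le> r * t\<^sup>2"
        using r by (intro mult_left_mono power_mono) simp_all
      ultimately show ?thesis
        by (simp add: power2_norm_eq_inner inner_diff_left inner_diff_right inner_commute algebra_simps)
    qed
    then have "convex hull \<sigma> \<subseteq> {x. ((2 * R) *\<^sub>R n - (2 * r) *\<^sub>R (c - q)) \<bullet> x
        \<le> 2 * R * (q \<bullet> n) + r * (t\<^sup>2 + (norm q)\<^sup>2 - (norm c)\<^sup>2)}"
      by (intro hull_minimal convex_halfspace_le) auto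
    with \<sigma>(2) have "((2 * R) *\<^sub>R n - (2 * r) *\<^sub>R (c - q)) \<bullet> y
        \<le> 2 * R * (q \<bullet> n) + r * (t\<^sup>2 + (norm q)\<^sup>2 - (norm c)\<^sup>2)"
      by auto
    then have "2 * R * (n \<bullet> n) \<le> r * (t\<^sup>2 + (norm n)\<^sup>2 - (norm (y - c))\<^sup>2)"
      by (simp add: n_def power2_norm_eq_inner inner_diff_left inner_diff_right inner_commute algebra_simps)
    then show ?thesis
      by (simp add: r dot_square_norm power2_eq_square mult.commute mult.left_commute)
  qed
  then have key: "2 * R * r \<le> t\<^sup>2 + r\<^sup>2 - (norm (y - c))\<^sup>2" if "r \<noteq> 0"
    using r that by (metis mult_left_le_imp_le order_less_le)
  show "2 * R * infdist y M \<le> t\<^sup>2 + (infdist y M)\<^sup>2"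
  proof (cases "r = 0")
    case False
    then show ?thesis
      unfolding r_def[symmetric] using key zero_le_power2[of "norm (y - c)"] by linarith
  qed (simp add: r_def)
  have "norm (y - c) \<le> t - r"
  proof (cases "r = 0")
    case True
    have "y \<in> cball c t"
      using \<sigma> hull_minimal[of \<sigma> "cball c t" convex] by auto
    then show ?thesis using True by (simp add: dist_norm norm_minus_commute)
  next
    case False
    have "t * r \<le> R * r" using \<open>t \<le> R\<close> r by (intro mult_right_mono)
    then have "(norm (y - c))\<^sup>2 \<le> (t - r)\<^sup>2"
      using key[OF False] by (simp add: power2_diff)
    then show ?thesis using r by - (rule power2_le_imp_le, simp_all)
  qed
  then show "dist c q \<le> t"
    using norm_triangle_ineq4[of "y - c" n] r by (simp add: n_def dist_norm norm_minus_commute)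
qed

text \<open>
  The points of the convex hull that have a nearest point in \<open>cball c t\<close> and those that have one outside
  \<open>ball c t'\<close> form closed sets, disjoint by uniqueness, which cover the hull by \<open>foot_point_bound\<close>. The former
  contains \<open>\<sigma>\<close>, so by connectedness it is the whole hull.
\<close>

lemma convex_hull_distance_bound:
  fixes M :: "'a::euclidean_space set"
  assumes "compact M" and \<sigma>: "\<sigma> \<subseteq> M" "\<sigma> \<subseteq> cball c t" "y \<in> convex hull \<sigma>"
    and "t \<le> R" "t < \<delta>" "t < t'"
    and unique: "\<And>x. infdist x M < \<delta> \<Longrightarrow> \<exists>!q. q \<in> M \<and> dist x q = infdist x M"
    and avoid: "\<And>a b. \<lbrakk>a \<in> M; b \<in> M; dist a b \<le> 2 * t'\<rbrakk> \<Longrightarrow> avoids_tangent_balls R M a b"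
  shows "2 * R * infdist y M \<le> t\<^sup>2 + (infdist y M)\<^sup>2"
proof -
  define near far where "near = M \<inter> cball c t" and "far = M - ball c t'"
  have cpt: "compact near" "compact far"
    using \<open>compact M\<close> by (simp_all add: near_def far_def compact_Int_closed compact_diff)
  have foot: "\<exists>q\<in>E. q \<in> M \<and> dist y q = infdist y M"
    if E: "compact E" "E \<subseteq> M" "E \<noteq> {}" "infdist y E \<le> infdist y M" for y E
  proof -
    obtain q where "q \<in> E" "infdist y E = dist y q"
      using infdist_attains_inf[of E y] E by (auto simp: compact_imp_closed)
    moreover then have "q \<in> M" using E by blast
    ultimately show ?thesis
      using E infdist_le[of q M y] by (intro bexI[of _ q]) auto
  qed
  have bounds: "2 * R * infdist y M \<le> t\<^sup>2 + (infdist y M)\<^sup>2 \<and> dist c q \<le> t"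
    if y: "y \<in> convex hull \<sigma>" and q: "q \<in> M" "dist y q = infdist y M" "dist c q < t'" for y q
  proof -
    have "avoids_tangent_balls R M q x" if "x \<in> \<sigma>" for x
    proof (rule avoid)
      have "dist c x \<le> t" using \<sigma>(2) that by auto
      then show "dist q x \<le> 2 * t'"
        using dist_triangle[of q x c] q \<open>t < t'\<close> by (simp add: dist_commute)
    qed (use q \<sigma> that in auto)
    then show ?thesis
      using foot_point_bound[OF \<sigma>(2) y \<open>t \<le> R\<close> q(1,2) infdist_convex_hull_le[OF \<sigma>(1,2) y]] by blast
  qed
  have "\<sigma> \<noteq> {}" using \<sigma>(3) by auto
  then have "near \<noteq> {}" using \<sigma> by (auto simp: near_def)
  have "M \<noteq> {}" using \<sigma> \<open>\<sigma> \<noteq> {}\<close> by auto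
  have foot_M: "\<exists>q\<in>M. dist y q = infdist y M" for y
    using foot[of M y] \<open>M \<noteq> {}\<close> \<open>compact M\<close> by auto
  have "\<exists>q\<in>M. dist y q = infdist y M \<and> dist c q < t'"
  proof (cases "far = {}")
    case True
    then have "M \<subseteq> ball c t'" by (simp add: far_def)
    then show ?thesis using foot_M[of y] mem_ball by blast
  next
    case False
    let ?A = "{y. infdist y near \<le> infdist y M}" and ?B = "{y. infdist y far \<le> infdist y M}"
    have "closed ?A" "closed ?B"
      by (intro closed_Collect_le continuous_intros)+
    moreover have "?A \<inter> ?B \<inter> convex hull \<sigma> = {}"
    proof (rule ccontr)
      assume "?A \<inter> ?B \<inter> convex hull \<sigma> \<noteq> {}"
      then obtain y where y: "infdist y near \<le> infdist y M" "infdist y far \<le> infdist y M"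
        "y \<in> convex hull \<sigma>" by blast
      obtain q where q: "q \<in> near" "q \<in> M" "dist y q = infdist y M"
        using foot[OF cpt(1) _ \<open>near \<noteq> {}\<close> y(1)] by (auto simp: near_def)
      obtain q' where q': "q' \<in> far" "q' \<in> M" "dist y q' = infdist y M"
        using foot[OF cpt(2) _ False y(2)] by (auto simp: far_def)
      have "infdist y M < \<delta>"
        using infdist_convex_hull_le[OF \<sigma>(1,2) y(3)] \<open>t < \<delta>\<close> by simp
      from unique[OF this] q q' have "q = q'" by blast
      with q q' \<open>t < t'\<close> show False by (auto simp: near_def far_def)
    qed
    moreover have "convex hull \<sigma> \<subseteq> ?A \<union> ?B"
    proof
      fix y assume y: "y \<in> convex hull \<sigma>"
      obtain q where q: "q \<in> M" "dist y q = infdist y M" using foot_M by blast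
      show "y \<in> ?A \<union> ?B"
      proof (cases "dist c q < t'")
        case True
        then have "q \<in> near" using bounds[OF y q] q by (simp add: near_def)
        from infdist_le[OF this, of y] q show ?thesis by simp
      next
        case False
        then have "q \<in> far" using q by (simp add: far_def)
        from infdist_le[OF this, of y] q show ?thesis by simp
      qed
    qed
    moreover have "connected (convex hull \<sigma>)"
      by (simp add: convex_connected)
    ultimately have "?A \<inter> convex hull \<sigma> = {} \<or> ?B \<inter> convex hull \<sigma> = {}"
      by - (rule connected_closedD)
    moreover obtain x where x: "x \<in> \<sigma>" using \<open>\<sigma> \<noteq> {}\<close> by blast
    then have "x \<in> near" using \<sigma> by (auto simp: near_def)
    from infdist_le[OF this, of x] have "infdist x near \<le> infdist x M"
      by (simp add: infdist_nonneg order_trans)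
    then have "?A \<inter> convex hull \<sigma> \<noteq> {}"
      using hull_inc[OF x] by blast
    ultimately have "y \<notin> ?B" using \<sigma>(3) by blast
    moreover obtain q where q: "q \<in> M" "dist y q = infdist y M" using foot_M by blast
    ultimately have "q \<notin> far"
      using infdist_le[of q far y] by auto
    then show ?thesis using q by (auto simp: far_def)
  qed
  then show ?thesis using bounds[OF \<sigma>(3)] by blast
qed

section \<open>The bound on the convexity defect\<close>

lemma quarter_circle_bound:
  fixes \<rho> r t :: real
  assumes "0 \<le> t" "t \<le> \<rho>" "r \<le> t" "2 * \<rho> * r \<le> t\<^sup>2 + r\<^sup>2"
  shows "r \<le> \<rho> - sqrt (\<rho>\<^sup>2 - t\<^sup>2)"
proof -
  have "\<rho>\<^sup>2 - t\<^sup>2 \<le> (\<rho> - r)\<^sup>2" using assms by (simp add: power2_diff)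
  then have "sqrt (\<rho>\<^sup>2 - t\<^sup>2) \<le> \<rho> - r" using assms by (intro real_le_lsqrt) simp_all
  then show ?thesis by simp
qed

text \<open>
  The root is that of a number that is not positive, where \<open>sqrt (- x) = - sqrt x\<close>. This covers an infinite local
  reach as well, since \<open>real_of_ereal\<close> maps it to \<open>0\<close>.
\<close>

lemma quarter_circle_degenerate:
  fixes \<rho> t :: real
  assumes "0 \<le> \<rho>" "\<rho> \<le> t"
  shows "t \<le> \<rho> - sqrt (\<rho>\<^sup>2 - t\<^sup>2)"
proof -
  have "(t - \<rho>) * (t - \<rho>) \<le> (t - \<rho>) * (t + \<rho>)" using assms by (intro mult_left_mono) simp_all
  then have "(t - \<rho>)\<^sup>2 \<le> t\<^sup>2 - \<rho>\<^sup>2" by (simp add: power2_eq_square algebra_simps)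
  then have "t - \<rho> \<le> sqrt (t\<^sup>2 - \<rho>\<^sup>2)" by (rule real_le_rsqrt)
  then show ?thesis using real_sqrt_minus[of "t\<^sup>2 - \<rho>\<^sup>2"] by simp
qed

text \<open>
  The larger radius \<open>s\<close> makes up for not knowing whether the infimum in \<open>Rad\<close> is attained.
\<close>

lemma Rad_le_imp_subset_cball:
  assumes "bounded \<sigma>" "Rad \<sigma> \<le> t" "t < s"
  obtains c where "\<sigma> \<subseteq> cball c s"
proof -
  let ?A = "{r. 0 \<le> r \<and> (\<exists>c. \<sigma> \<subseteq> cball c r)}"
  obtain c e where "\<sigma> \<subseteq> cball c e"
    using assms(1) by (meson bounded_subset_cball)
  then have "max 0 e \<in> ?A"
    using subset_cball[of e "max 0 e" c] by auto
  then have "?A \<noteq> {}" by blast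
  moreover have "Inf ?A < s" using assms by (simp add: Rad_def)
  ultimately have "\<exists>r\<in>?A. r < s" by (rule cInf_lessD)
  then obtain r c where "r < s" "\<sigma> \<subseteq> cball c r" by auto
  then show thesis
    using that[of c] subset_cball[of r s c] by auto
qed

lemma second_fundamental_form_onorm_nonneg:
  assumes "p \<in> M"
  shows "0 \<le> second_fundamental_form_onorm M p"
proof -
  have "0 \<in> tangent_space M p"
    unfolding tangent_space_def using assms
    by (intro CollectI exI[of _ "\<lambda>_. p"] exI[of _ 1]) auto
  then have "ereal (norm (second_fundamental_form M p 0 0)) \<le> second_fundamental_form_onorm M p"
    unfolding second_fundamental_form_onorm_def by (intro SUP_upper2[of "(0, 0)"]) simp_all
  then show ?thesis by (rule order_trans[rotated]) simp
qed

lemma local_reach_nonneg: "0 \<le> local_reach M"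
  unfolding local_reach_def
  by (intro INF_greatest) (simp add: second_fundamental_form_onorm_nonneg)

lemma second_fundamental_form_onorm_le:
  assumes "p \<in> M" "local_reach M = ereal \<rho>" "0 < \<rho>"
  shows "second_fundamental_form_onorm M p \<le> ereal (1 / \<rho>)"
proof -
  have "ereal \<rho> \<le> 1 / second_fundamental_form_onorm M p"
    unfolding assms(2)[symmetric] local_reach_def using assms(1) by (rule INF_lower)
  then show ?thesis
    using second_fundamental_form_onorm_nonneg[OF assms(1)] assms(3)
    by (cases "second_fundamental_form_onorm M p") (auto simp: field_simps zero_ereal_def one_ereal_def split: if_splits)
qed

text \<open>
  The preceding estimates hold for radii \<open>s\<close> slightly above \<open>t\<close> and \<open>R\<close> slightly below \<open>\<rho>\<close>; both are sent to their
  limits.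
\<close>

lemma hull_point_bound:
  fixes M :: "'a::euclidean_space set"
  assumes M: "compact M" "submanifold k d M" "2 \<le> k"
    and \<rho>: "local_reach M = ereal \<rho>" "t < \<rho>"
    and "0 \<le> t" "t < \<delta>"
    and unique: "\<And>x. infdist x M < \<delta> \<Longrightarrow> \<exists>!q. q \<in> M \<and> dist x q = infdist x M"
    and \<sigma>: "\<sigma> \<subseteq> M" "Rad \<sigma> \<le> t" "y \<in> convex hull \<sigma>"
  shows "2 * \<rho> * infdist y M \<le> t\<^sup>2 + (infdist y M)\<^sup>2"
proof -
  define r where "r = infdist y M"
  have bound: "2 * R * r \<le> s\<^sup>2 + r\<^sup>2" if Rs: "t < s" "s < \<delta>" "s < R" "R < \<rho>" for R s
  proof -
    define s' where "s' = (s + min \<delta> R) / 2"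
    have s': "s < s'" "s' < \<delta>" "s' < R" using Rs by (simp_all add: s'_def min_def field_simps)
    have "0 < R" "0 < \<rho>" using Rs \<open>0 \<le> t\<close> by simp_all
    obtain h\<^sub>0 where h\<^sub>0: "0 < h\<^sub>0"
      "\<And>a b. \<lbrakk>a \<in> M; b \<in> M; dist a b < h\<^sub>0\<rbrakk> \<Longrightarrow> avoids_tangent_balls R M a b"
    proof (rule submanifold_avoids_tangent_balls_locally[OF M])
      show "1 / \<rho> * R < 1" using \<open>0 < \<rho>\<close> Rs by simp
    qed (use \<open>0 < R\<close> \<open>0 < \<rho>\<close> second_fundamental_form_onorm_le[OF _ \<rho>(1)] in auto)
    have "bounded \<sigma>" using \<sigma>(1) M(1) compact_imp_bounded bounded_subset by blast
    then obtain c where "\<sigma> \<subseteq> cball c s"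
      using Rad_le_imp_subset_cball \<sigma>(2) Rs(1) by blast
    moreover have "avoids_tangent_balls R M a b" if "a \<in> M" "b \<in> M" "dist a b \<le> 2 * s'" for a b
      using avoids_tangent_balls_global[OF M(1) \<open>0 < R\<close> _ s'(2) h\<^sub>0(1) unique h\<^sub>0(2) that] s'(3) by simp
    ultimately show ?thesis
      unfolding r_def using convex_hull_distance_bound[OF M(1) \<sigma>(1) _ \<sigma>(3) _ _ s'(1) unique] Rs by simp
  qed
  have *: "2 * R * r \<le> t\<^sup>2 + r\<^sup>2" if "t < R" "R < \<rho>" for R
  proof (rule tendsto_lowerbound)
    show "((\<lambda>s. s\<^sup>2 + r\<^sup>2) \<longlongrightarrow> t\<^sup>2 + r\<^sup>2) (at_right t)"
      by (intro tendsto_intros)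
    have "\<forall>\<^sub>F s in at_right t. s \<in> {t<..<min \<delta> R}"
      using that \<open>t < \<delta>\<close> by (intro eventually_at_rightI[of t "min \<delta> R"]) simp_all
    then show "\<forall>\<^sub>F s in at_right t. 2 * R * r \<le> s\<^sup>2 + r\<^sup>2"
      by eventually_elim (use bound that in auto)
  qed simp
  have "2 * \<rho> * r \<le> t\<^sup>2 + r\<^sup>2"
  proof (rule tendsto_upperbound)
    show "((\<lambda>R. 2 * R * r) \<longlongrightarrow> 2 * \<rho> * r) (at_left \<rho>)"
      by (intro tendsto_intros)
    have "\<forall>\<^sub>F R in at_left \<rho>. R \<in> {t<..<\<rho>}"
      using \<rho>(2) by (intro eventually_at_leftI[of t \<rho>]) simp_all
    then show "\<forall>\<^sub>F R in at_left \<rho>. 2 * R * r \<le> t\<^sup>2 + r\<^sup>2"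
      by eventually_elim (use * in auto)
  qed simp
  then show ?thesis by (simp add: r_def)
qed

theorem proposition4p4:
  fixes M :: "'a::euclidean_space set"
    and d k :: nat and Rmin Lp t :: real and L :: "nat \<Rightarrow> real"
  assumes "1 \<le> d" and "d < DIM('a)" and "3 \<le> k"
    and "0 < Rmin" and "0 < Lp" and "\<forall>i\<in>{3..k}. 0 < L i"
    and "M \<in> manifold_class d k Rmin Lp L"
    and "0 \<le> t" and "ereal t < reach M"
  shows "convexity_defect M t \<le>
    real_of_ereal (local_reach M) - sqrt ((real_of_ereal (local_reach M))\<^sup>2 - t\<^sup>2)"
proof -
  define \<rho> where "\<rho> = real_of_ereal (local_reach M)"
  have M: "M \<noteq> {}" "compact M" "submanifold k d M"
    using assms(7) by (simp_all add: manifold_class_def)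
  obtain \<delta> where \<delta>_reach: "\<delta> \<in> {\<delta>. 0 \<le> \<delta> \<and>
      (\<forall>x. infdist x M < \<delta> \<longrightarrow> (\<exists>!q. q \<in> M \<and> dist x q = infdist x M))}" 
    and "ereal t < ereal \<delta>"
    using assms(9) unfolding reach_def less_SUP_iff by (elim bexE)
  then have "t < \<delta>" by simp
  have unique: "\<exists>!q. q \<in> M \<and> dist x q = infdist x M" if "infdist x M < \<delta>" for x
    using \<delta>_reach that by (elim CollectE conjE) (drule spec, erule mp)
  have "infdist y M \<le> \<rho> - sqrt (\<rho>\<^sup>2 - t\<^sup>2)" if y: "y \<in> Hull M t" for y
  proof -
    obtain \<sigma> where \<sigma>: "\<sigma> \<subseteq> M" "compact \<sigma>" "Rad \<sigma> \<le> t" "y \<in> convex hull \<sigma>"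
      using y unfolding Hull_def by blast
    have r_le: "infdist y M \<le> t"
    proof (rule dense_ge)
      fix s assume "t < s"
      then obtain c where "\<sigma> \<subseteq> cball c s"
        using Rad_le_imp_subset_cball \<sigma> compact_imp_bounded by blast
      then show "infdist y M \<le> s" using infdist_convex_hull_le \<sigma> by blast
    qed
    show ?thesis
    proof (cases "t < \<rho>")
      case True
      then have "local_reach M = ereal \<rho>"
        using \<open>0 \<le> t\<close> unfolding \<rho>_def by (cases "local_reach M") auto
      then have "2 * \<rho> * infdist y M \<le> t\<^sup>2 + (infdist y M)\<^sup>2"
        using hull_point_bound[OF M(2,3) _ _ True \<open>0 \<le> t\<close> \<open>t < \<delta>\<close> unique \<sigma>(1,3,4)] \<open>3 \<le> k\<close> by simp
      then show ?thesis
        using True \<open>0 \<le> t\<close> r_le by (intro quarter_circle_bound) simp_all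
    next
      case False
      have "0 \<le> \<rho>" unfolding \<rho>_def using local_reach_nonneg by (rule real_of_ereal_pos)
      with False r_le quarter_circle_degenerate[of \<rho> t] show ?thesis by simp
    qed
  qed
  moreover have "Hull M t \<noteq> {}"
  proof -
    obtain p where "p \<in> M" using M(1) by blast
    have "Rad {p} \<le> t"
      unfolding Rad_def using \<open>0 \<le> t\<close>
      by (intro cInf_lower2[of 0]) (auto intro!: bdd_belowI[of _ 0] exI[of _ p])
    with \<open>p \<in> M\<close> have "p \<in> Hull M t"
      unfolding Hull_def by (intro UN_I[of "{p}"]) auto
    then show ?thesis by blast
  qed
  ultimately show ?thesis
    unfolding convexity_defect_def \<rho>_def[symmetric] by (intro cSUP_least)
qed

end
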